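(* Let $G$ be a torsion-free nilpotent group of nilpotency class $3$ that can be generated by $2$ elements. Then $G$ is strongly recurrent self-similar; that is, for every finite-index subgroup $H$ of $G$ there exist a finite-index subgroup $K$ of $H$ and a simple recurrent virtual endomorphism $f : K \to G$.
   Context: A virtual endomorphism of a group $G$ is a homomorphism $f : K \to G$ from a subgroup $K \leqslant G$ of finite index into $G$. The $f$-core of $K$ is the largest subgroup $N \leqslant K$ which is normal in $G$ and $f$-invariant ($N^f \leqslant N$). The virtual endomorphism $f$ is simple if the $f$-core of $K$ is trivial, i.e. the only subgroup $N \leqslant K$ with $N \trianglelefteq G$ and $N^f \leqslant N$ is $N = 1$. It is recurrent if $f : K \to G$ is surjective. A group $G$ is strongly recurrent self-similar if for every finite-index subgroup $H$ of $G$ there exist a finite-index subgroup $K$ of $H$ and a simple recurrent virtual endomorphism $f : K \to G$. *)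

theory Defs
  imports "HOL-Algebra.Algebra"
begin

definition commutator :: "('a, 'b) monoid_scheme \<Rightarrow> 'a \<Rightarrow> 'a \<Rightarrow> 'a" where
  "commutator G x y = inv\<^bsub>G\<^esub> x \<otimes>\<^bsub>G\<^esub> inv\<^bsub>G\<^esub> y \<otimes>\<^bsub>G\<^esub> x \<otimes>\<^bsub>G\<^esub> y"

(* Indexed from 0: lower_central G n is the term usually written \<gamma>_(n+1)(G). *)
fun lower_central :: "('a, 'b) monoid_scheme \<Rightarrow> nat \<Rightarrow> 'a set" where
  "lower_central G 0 = carrier G"
| "lower_central G (Suc n) =
     generate G {commutator G x y | x y. x \<in> lower_central G n \<and> y \<in> carrier G}"

(* The class is exactly c, not merely at most c. *)
definition has_nilpotency_class :: "('a, 'b) monoid_scheme \<Rightarrow> nat \<Rightarrow> bool" where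
  "has_nilpotency_class G c \<longleftrightarrow>
     lower_central G c = {\<one>\<^bsub>G\<^esub>} \<and> (\<forall>m<c. lower_central G m \<noteq> {\<one>\<^bsub>G\<^esub>})"

definition torsion_free_group :: "('a, 'b) monoid_scheme \<Rightarrow> bool" where
  "torsion_free_group G \<longleftrightarrow>
     (\<forall>x\<in>carrier G. \<forall>n::nat. n > 0 \<longrightarrow> x [^]\<^bsub>G\<^esub> n = \<one>\<^bsub>G\<^esub> \<longrightarrow> x = \<one>\<^bsub>G\<^esub>)"

definition finite_index_subgroup :: "'a set \<Rightarrow> ('a, 'b) monoid_scheme \<Rightarrow> bool" where
  "finite_index_subgroup K G \<longleftrightarrow> subgroup K G \<and> finite (rcosets\<^bsub>G\<^esub> K)"

(* Only the values of f on K matter. *)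
definition virtual_endomorphism ::
  "('a, 'b) monoid_scheme \<Rightarrow> 'a set \<Rightarrow> ('a \<Rightarrow> 'a) \<Rightarrow> bool" where
  "virtual_endomorphism G K f \<longleftrightarrow>
     finite_index_subgroup K G \<and> f \<in> hom (G\<lparr>carrier := K\<rparr>) G"

(* Equivalent to triviality of the f-core of K, the largest subgroup N of K that is
   normal in G and f-invariant. *)
definition simple_virtual_endomorphism ::
  "('a, 'b) monoid_scheme \<Rightarrow> 'a set \<Rightarrow> ('a \<Rightarrow> 'a) \<Rightarrow> bool" where
  "simple_virtual_endomorphism G K f \<longleftrightarrow>
     virtual_endomorphism G K f \<and>
     (\<forall>N. N \<lhd> G \<and> N \<subseteq> K \<and> f ` N \<subseteq> N \<longrightarrow> N = {\<one>\<^bsub>G\<^esub>})"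

definition recurrent_virtual_endomorphism ::
  "('a, 'b) monoid_scheme \<Rightarrow> 'a set \<Rightarrow> ('a \<Rightarrow> 'a) \<Rightarrow> bool" where
  "recurrent_virtual_endomorphism G K f \<longleftrightarrow>
     virtual_endomorphism G K f \<and> f ` K = carrier G"

definition strongly_recurrent_self_similar :: "('a, 'b) monoid_scheme \<Rightarrow> bool" where
  "strongly_recurrent_self_similar G \<longleftrightarrow>
     (\<forall>H. finite_index_subgroup H G \<longrightarrow>
        (\<exists>K f. finite_index_subgroup K (G\<lparr>carrier := H\<rparr>) \<and>
               simple_virtual_endomorphism G K f \<and>
               recurrent_virtual_endomorphism G K f))"

end

theory Submission
  imports Defs
begin

text \<open>Let \<open>G\<close> be generated by \<open>a\<close> and \<open>b\<close>, and put \<open>c = [a, b]\<close>, \<open>d = [c, a]\<close>, \<open>e = [c, b]\<close>. Every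
  element of \<open>G\<close> is of the form \<open>s c\<^sup>z b\<^sup>y a\<^sup>x\<close> with \<open>s\<close> in the central subgroup \<open>T\<close> generated by \<open>d\<close>
  and \<open>e\<close>, and \<open>s, z, y, x\<close> are unique, because no nontrivial power of \<open>c\<close> lies in \<open>T\<close> and \<open>G / T\<close> is a
  Heisenberg group. For \<open>n \<ge> 2\<close> the rule \<open>a \<mapsto> a\<^sup>n\<close>, \<open>b \<mapsto> b\<^sup>n\<close> defines an injective endomorphism of \<open>G\<close>
  whatever the relations between \<open>d\<close> and \<open>e\<close> are, since by trilinearity of triple commutators it
  must act on \<open>T\<close> as the power map \<open>s \<mapsto> s ^ (n ^ 3)\<close>. Its image \<open>K\<close> has finite index, it lies in a
  given finite-index subgroup \<open>H\<close> as soon as \<open>a\<^sup>n, b\<^sup>n \<in> H\<close>, and \<open>f\<close> is the inverse map \<open>K \<rightarrow> G\<close>. If \<open>f\<close>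
  maps \<open>N\<close> into \<open>N\<close>, then the exponents \<open>x\<close>, \<open>y\<close>, \<open>z\<close> of elements of \<open>N\<close> are infinitely divisible by
  \<open>n\<close>, so \<open>N\<close> lies in \<open>T\<close>; there it is a divisible subset of a finitely generated torsion-free
  abelian group, hence trivial.\<close>

subsection \<open>Extensions by a cyclic group\<close>

text \<open>Both directions of conjugation are demanded because in an infinite group
  \<open>g N g^-1 \<subseteq> N\<close> may be a proper inclusion. With both, the condition passes
  to inverses and hence to all integer powers of \<open>g\<close>.\<close>

definition normalizes :: "('a, 'b) monoid_scheme \<Rightarrow> 'a \<Rightarrow> 'a set \<Rightarrow> bool" where
  "normalizes G g N \<longleftrightarrow>
     (\<forall>n\<in>N. g \<otimes>\<^bsub>G\<^esub> n \<otimes>\<^bsub>G\<^esub> inv\<^bsub>G\<^esub> g \<in> N \<and> inv\<^bsub>G\<^esub> g \<otimes>\<^bsub>G\<^esub> n \<otimes>\<^bsub>G\<^esub> g \<in> N)"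

definition cyclic_ext :: "('a, 'b) monoid_scheme \<Rightarrow> 'a set \<Rightarrow> 'a \<Rightarrow> 'a set" where
  "cyclic_ext G N g = {n \<otimes>\<^bsub>G\<^esub> g [^]\<^bsub>G\<^esub> i | n (i::int). n \<in> N}"

context group
begin

lemma mult_inv_cancel:
  assumes "x \<in> carrier G" "y \<in> carrier G"
  shows "inv x \<otimes> (x \<otimes> y) = y" "x \<otimes> (inv x \<otimes> y) = y"
  using assms by (simp_all flip: m_assoc)

lemma conj_hom:
  assumes "g \<in> carrier G"
  shows "(\<lambda>x. g \<otimes> x \<otimes> inv g) \<in> hom G G"
proof (rule homI)
  fix x y assume "x \<in> carrier G" "y \<in> carrier G"
  then show "g \<otimes> (x \<otimes> y) \<otimes> inv g = g \<otimes> x \<otimes> inv g \<otimes> (g \<otimes> y \<otimes> inv g)"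
    using assms by (simp add: m_assoc mult_inv_cancel)
qed (use assms in auto)

lemma conj_mult:
  assumes "g \<in> carrier G" "x \<in> carrier G" "y \<in> carrier G"
  shows "g \<otimes> (x \<otimes> y) \<otimes> inv g = g \<otimes> x \<otimes> inv g \<otimes> (g \<otimes> y \<otimes> inv g)"
  using hom_mult[OF conj_hom] assms by simp

lemma conj_int_pow:
  assumes "g \<in> carrier G" "x \<in> carrier G"
  shows "g \<otimes> x [^] (i::int) \<otimes> inv g = (g \<otimes> x \<otimes> inv g) [^] i"
  using hom_int_pow[OF conj_hom] assms is_group by simp

lemma normalizes_inv:
  assumes "g \<in> carrier G" "normalizes G g N"
  shows "normalizes G (inv g) N"
  using assms unfolding normalizes_def by simp

lemma normalizes_mult:
  assumes "g \<in> carrier G" "h \<in> carrier G" "N \<subseteq> carrier G"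
    and "normalizes G g N" "normalizes G h N"
  shows "normalizes G (g \<otimes> h) N"
  unfolding normalizes_def
proof
  fix n assume n: "n \<in> N"
  then have nc: "n \<in> carrier G" using assms(3) by blast
  have "g \<otimes> h \<otimes> n \<otimes> inv (g \<otimes> h) = g \<otimes> (h \<otimes> n \<otimes> inv h) \<otimes> inv g"
    "inv (g \<otimes> h) \<otimes> n \<otimes> (g \<otimes> h) = inv h \<otimes> (inv g \<otimes> n \<otimes> g) \<otimes> h"
    using assms(1,2) nc by (simp_all add: m_assoc inv_mult_group)
  then show "g \<otimes> h \<otimes> n \<otimes> inv (g \<otimes> h) \<in> N \<and> inv (g \<otimes> h) \<otimes> n \<otimes> (g \<otimes> h) \<in> N"
    using assms(4,5) n unfolding normalizes_def by simp
qed

lemma normalizes_nat_pow: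
  assumes "g \<in> carrier G" "N \<subseteq> carrier G" "normalizes G g N"
  shows "normalizes G (g [^] (k::nat)) N"
proof (induction k)
  case 0
  then show ?case using assms(2) by (auto simp: normalizes_def)
next
  case (Suc k)
  then show ?case using normalizes_mult[OF nat_pow_closed[OF assms(1)] assms(1,2) _ assms(3)] by simp
qed

lemma normalizes_int_pow:
  assumes "g \<in> carrier G" "N \<subseteq> carrier G" "normalizes G g N"
  shows "normalizes G (g [^] (k::int)) N"
proof (cases k rule: int_cases)
  case (nonneg n)
  then show ?thesis using normalizes_nat_pow[OF assms] by (simp add: int_pow_int)
next
  case (neg n)
  then show ?thesis
    using normalizes_inv[OF nat_pow_closed[OF assms(1)] normalizes_nat_pow[OF assms]] assms(1)
    by (simp only: int_pow_neg_int)
qed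

lemma cyclic_ext_subset_carrier:
  assumes "N \<subseteq> carrier G" "g \<in> carrier G"
  shows "cyclic_ext G N g \<subseteq> carrier G"
  using assms by (auto simp: cyclic_ext_def)

lemma cyclic_extI: "n \<in> N \<Longrightarrow> n \<otimes> g [^] (i::int) \<in> cyclic_ext G N g"
  unfolding cyclic_ext_def by blast

lemma cyclic_ext_iff: "h \<in> cyclic_ext G N g \<longleftrightarrow> (\<exists>n\<in>N. \<exists>i::int. h = n \<otimes> g [^] i)"
  unfolding cyclic_ext_def by blast

lemma subset_cyclic_ext:
  assumes "N \<subseteq> carrier G"
  shows "N \<subseteq> cyclic_ext G N g"
proof
  fix n assume "n \<in> N"
  then show "n \<in> cyclic_ext G N g"
    using cyclic_extI[of n N g 0] assms by auto
qed

lemma in_cyclic_ext: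
  assumes "\<one> \<in> N" "g \<in> carrier G"
  shows "g \<in> cyclic_ext G N g"
  using cyclic_extI[of \<one> N g 1] assms by simp

text \<open>Moving powers of \<open>g\<close> to the right turns \<open>n g^i m g^j\<close> into
  \<open>n (g^i m g^-i) g^(i+j)\<close>, and the conjugate of \<open>m\<close> stays in
  \<open>N\<close>.\<close>

lemma subgroup_cyclic_ext:
  assumes N: "subgroup N G" and g: "g \<in> carrier G" and norm: "normalizes G g N"
  shows "subgroup (cyclic_ext G N g) G"
proof (rule subgroupI)
  have Nc: "N \<subseteq> carrier G" using N subgroup.subset by blast
  show "cyclic_ext G N g \<subseteq> carrier G"
    using cyclic_ext_subset_carrier Nc g by blast
  show "cyclic_ext G N g \<noteq> {}"
    using in_cyclic_ext subgroup.one_closed[OF N] g by blast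
  have conj: "g [^] i \<otimes> n \<otimes> inv (g [^] i) \<in> N" if "n \<in> N" for n and i :: int
    using normalizes_int_pow[OF g Nc norm, of i] that unfolding normalizes_def by blast
  fix u assume "u \<in> cyclic_ext G N g"
  then obtain n i where u: "u = n \<otimes> g [^] (i::int)" and n: "n \<in> N"
    unfolding cyclic_ext_def by blast
  have nc: "n \<in> carrier G" using n Nc by blast
  have "inv u = (g [^] (-i) \<otimes> inv n \<otimes> inv (g [^] (-i))) \<otimes> g [^] (-i)"
    using u nc g by (simp add: inv_mult_group m_assoc int_pow_neg mult_inv_cancel)
  then show "inv u \<in> cyclic_ext G N g"
    using cyclic_extI[OF conj[OF subgroup.m_inv_closed[OF N n], of "-i"]] by simp
  fix v assume "v \<in> cyclic_ext G N g"
  then obtain m j where v: "v = m \<otimes> g [^] (j::int)" and m: "m \<in> N"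
    unfolding cyclic_ext_def by blast
  have mc: "m \<in> carrier G" using m Nc by blast
  have "u \<otimes> v = (n \<otimes> (g [^] i \<otimes> m \<otimes> inv (g [^] i))) \<otimes> g [^] (i + j)"
    using u v nc mc g by (simp add: int_pow_mult m_assoc mult_inv_cancel)
  moreover have "n \<otimes> (g [^] i \<otimes> m \<otimes> inv (g [^] i)) \<in> N"
    using conj[OF m] n subgroup.m_closed[OF N] by blast
  ultimately show "u \<otimes> v \<in> cyclic_ext G N g"
    by (simp add: cyclic_extI)
qed

text \<open>Conjugation is a homomorphism, so it has to be checked only on \<open>N\<close> and on
  the new generator \<open>u\<close>. This carries normalization up a tower of cyclic
  extensions.\<close>

lemma normalizes_cyclic_extI:
  assumes N: "subgroup N G"
    and sub: "N' = cyclic_ext G N u" and H: "subgroup N' G"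
    and g: "g \<in> carrier G" and u: "u \<in> carrier G"
    and norm: "normalizes G g N"
    and "g \<otimes> u \<otimes> inv g \<in> N'" "inv g \<otimes> u \<otimes> g \<in> N'"
  shows "normalizes G g N'"
proof -
  have Nc: "N \<subseteq> carrier G" using N subgroup.subset by blast
  have *: "h \<otimes> x \<otimes> inv h \<in> N'"
    if "x \<in> N'" "h \<in> carrier G" "h \<otimes> u \<otimes> inv h \<in> N'" "normalizes G h N" for h x
  proof -
    obtain n i where x: "x = n \<otimes> u [^] (i::int)" and n: "n \<in> N"
      using \<open>x \<in> N'\<close> sub unfolding cyclic_ext_def by blast
    have "h \<otimes> x \<otimes> inv h = (h \<otimes> n \<otimes> inv h) \<otimes> (h \<otimes> u \<otimes> inv h) [^] i"
      using x n Nc that u by (simp add: conj_mult conj_int_pow subset_iff)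
    moreover have "h \<otimes> n \<otimes> inv h \<in> N'"
      using that(4) n sub subset_cyclic_ext[OF Nc] unfolding normalizes_def by blast
    ultimately show ?thesis
      using subgroup.m_closed[OF H] subgroup_int_pow_closed[OF H that(3)] by simp
  qed
  show ?thesis
    unfolding normalizes_def
  proof (intro ballI conjI)
    fix x assume x: "x \<in> N'"
    show "g \<otimes> x \<otimes> inv g \<in> N'"
      by (rule *[OF x g _ norm]) fact
    have "inv g \<otimes> x \<otimes> inv (inv g) \<in> N'"
      by (rule *[OF x _ _ normalizes_inv[OF g norm]]) (use assms in simp_all)
    then show "inv g \<otimes> x \<otimes> g \<in> N'" using g by simp
  qed
qed

text \<open>With \<open>i = k (i div k) + r\<close>, the coset of \<open>n g^i\<close> is the coset
  of some element of \<open>N\<close> translated by \<open>g^r\<close>, and only \<open>k\<close>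
  values of \<open>r\<close> occur.\<close>

lemma finite_cosets_cyclic_ext:
  assumes K: "subgroup K G" and N: "N \<subseteq> carrier G" and g: "g \<in> carrier G"
    and norm: "normalizes G g N" and gk: "g [^] (k::nat) \<in> K" and k: "k > 0"
    and fin: "finite ((\<lambda>x. K #> x) ` N)"
  shows "finite ((\<lambda>x. K #> x) ` cyclic_ext G N g)"
proof (rule finite_subset)
  let ?F = "\<Union>r\<in>{0..<int k}. (\<lambda>C. C #> g [^] r) ` (\<lambda>x. K #> x) ` N"
  show "finite ?F" using fin by simp
  have Kc: "K \<subseteq> carrier G" using K subgroup.subset by blast
  show "(\<lambda>x. K #> x) ` cyclic_ext G N g \<subseteq> ?F"
  proof
    fix Y assume "Y \<in> (\<lambda>x. K #> x) ` cyclic_ext G N g"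
    then obtain n i where Y: "Y = K #> (n \<otimes> g [^] (i::int))" and n: "n \<in> N"
      unfolding cyclic_ext_def by blast
    define q where "q = g [^] (int k * (i div int k))"
    define r where "r = i mod int k"
    have r: "r \<in> {0..<int k}" using k unfolding r_def by simp
    have nc: "n \<in> carrier G" using n N by blast
    have qc: "q \<in> carrier G" unfolding q_def using g by simp
    have qK: "q \<in> K"
      unfolding q_def using subgroup_int_pow_closed[OF K gk] g
      by (simp add: int_pow_pow[symmetric] int_pow_int)
    have "g [^] i = q \<otimes> g [^] r"
      unfolding q_def r_def using g by (simp flip: int_pow_mult)
    \<comment> \<open>\<open>q\<close> is moved to the front, where \<open>K\<close> absorbs it, at
      the cost of conjugating \<open>n\<close> within \<open>N\<close>.\<close>
    then have "n \<otimes> g [^] i = q \<otimes> ((inv q \<otimes> n \<otimes> q) \<otimes> g [^] r)"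
      using g nc qc by (simp add: m_assoc mult_inv_cancel)
    then have "Y = (K #> q) #> ((inv q \<otimes> n \<otimes> q) \<otimes> g [^] r)"
      using Y qc nc g Kc by (simp add: coset_mult_assoc)
    also have "K #> q = K" using coset_join2 qc K qK by blast
    also have "K #> ((inv q \<otimes> n \<otimes> q) \<otimes> g [^] r) = (K #> (inv q \<otimes> n \<otimes> q)) #> g [^] r"
      using qc nc g Kc by (simp add: coset_mult_assoc)
    finally have "Y = (K #> (inv q \<otimes> n \<otimes> q)) #> g [^] r" .
    moreover have "inv q \<otimes> n \<otimes> q \<in> N"
      using normalizes_int_pow[OF g N norm] n unfolding q_def normalizes_def by blast
    ultimately show "Y \<in> ?F" using r by blast
  qed
qed

end

subsection \<open>Normal forms in two-generator groups of class three\<close>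

text \<open>These are the relations of \<open>c = [a, b]\<close>, \<open>d = [c, a]\<close>,
  \<open>e = [c, b]\<close> in class three, stated for five elements of any group. The locale thus
  applies both to \<open>G\<close> and to a tuple in \<open>G \<times>\<times> G\<close>.\<close>

locale class_3_tuple = group G for G (structure) +
  fixes a b c d e
  assumes in_carrier [simp]: "a \<in> carrier G" "b \<in> carrier G" "c \<in> carrier G"
      "d \<in> carrier G" "e \<in> carrier G"
    and ab: "a \<otimes> b = b \<otimes> a \<otimes> c"
    and ca: "c \<otimes> a = a \<otimes> c \<otimes> d"
    and cb: "c \<otimes> b = b \<otimes> c \<otimes> e"
    and d_comm: "d \<otimes> a = a \<otimes> d" "d \<otimes> b = b \<otimes> d" "d \<otimes> c = c \<otimes> d"
    and e_comm: "e \<otimes> a = a \<otimes> e" "e \<otimes> b = b \<otimes> e" "e \<otimes> c = c \<otimes> e" "e \<otimes> d = d \<otimes> e"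
begin

text \<open>Each term will be seen to be normalized by the next generator, so the tower consists of
  subgroups, and its top is the set of products \<open>e^j d^i c^z b^y a^x\<close>. The term
  \<open>ext_de\<close> is the subgroup \<open>T\<close>.\<close>

definition "ext_e = cyclic_ext G {\<one>} e"
definition "ext_de = cyclic_ext G ext_e d"
definition "ext_cde = cyclic_ext G ext_de c"
definition "ext_bcde = cyclic_ext G ext_cde b"
definition "ext_abcde = cyclic_ext G ext_bcde a"

lemma conj_commuting:
  assumes "x \<in> carrier G" "y \<in> carrier G" "x \<otimes> y = y \<otimes> x"
  shows "y \<otimes> x \<otimes> inv y = x" "inv y \<otimes> x \<otimes> y = x"
  using assms by (metis inv_solve_right m_closed, metis inv_solve_left m_assoc m_closed inv_closed)

lemma normalizes_one: "x \<in> carrier G \<Longrightarrow> normalizes G x {\<one>}"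
  by (simp add: normalizes_def)

lemma subgroup_e: "subgroup ext_e G"
  unfolding ext_e_def by (intro subgroup_cyclic_ext triv_subgroup normalizes_one) simp_all

lemma normalizes_e:
  assumes "x \<in> carrier G" "e \<otimes> x = x \<otimes> e"
  shows "normalizes G x ext_e"
  by (rule normalizes_cyclic_extI[OF triv_subgroup ext_e_def subgroup_e])
    (use assms conj_commuting[of e x] in_cyclic_ext[of "{\<one>}" e] in \<open>auto simp: normalizes_one ext_e_def\<close>)

lemma subgroup_de: "subgroup ext_de G"
  unfolding ext_de_def by (intro subgroup_cyclic_ext subgroup_e normalizes_e) (simp_all add: e_comm)

lemma d_in_de: "d \<in> ext_de"
  unfolding ext_de_def by (intro in_cyclic_ext subgroup.one_closed subgroup_e) simp

lemma e_in_de: "e \<in> ext_de"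
  unfolding ext_de_def
  using subset_cyclic_ext[OF subgroup.subset[OF subgroup_e]] in_cyclic_ext[of "{\<one>}" e]
  by (auto simp: ext_e_def)

lemma normalizes_de:
  assumes "x \<in> carrier G" "e \<otimes> x = x \<otimes> e" "d \<otimes> x = x \<otimes> d"
  shows "normalizes G x ext_de"
  by (rule normalizes_cyclic_extI[OF subgroup_e ext_de_def subgroup_de])
    (use assms conj_commuting[of d x] in \<open>auto simp: normalizes_e d_in_de\<close>)

lemma subgroup_cde: "subgroup ext_cde G"
  unfolding ext_cde_def
  by (intro subgroup_cyclic_ext subgroup_de normalizes_de) (simp_all add: e_comm d_comm)

lemma c_in_cde: "c \<in> ext_cde"
  unfolding ext_cde_def by (intro in_cyclic_ext subgroup.one_closed subgroup_de) simp

lemma de_subset_cde: "ext_de \<subseteq> ext_cde"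
  unfolding ext_cde_def by (intro subset_cyclic_ext subgroup.subset subgroup_de)

lemma conj_c:
  "inv a \<otimes> c \<otimes> a = c \<otimes> d" "a \<otimes> c \<otimes> inv a = c \<otimes> inv d"
  "inv b \<otimes> c \<otimes> b = c \<otimes> e" "b \<otimes> c \<otimes> inv b = c \<otimes> inv e"
proof -
  have *: "inv y \<otimes> c \<otimes> y = c \<otimes> z" "y \<otimes> c \<otimes> inv y = c \<otimes> inv z"
    if "y \<in> carrier G" "z \<in> carrier G" "c \<otimes> y = y \<otimes> c \<otimes> z" "z \<otimes> y = y \<otimes> z" for y z
  proof -
    show "inv y \<otimes> c \<otimes> y = c \<otimes> z"
      using that by (simp add: m_assoc mult_inv_cancel)
    \<comment> \<open>The first formula is conjugated back by \<open>y\<close>; since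
      \<open>z\<close> commutes with \<open>y\<close>, it can then be pulled out.\<close>
    have "c = y \<otimes> (c \<otimes> z) \<otimes> inv y"
      using that by (simp add: that(3)[symmetric] m_assoc[symmetric]) (simp add: m_assoc)
    also have "\<dots> = y \<otimes> c \<otimes> inv y \<otimes> z"
      using that conj_commuting(1)[of z y] by (simp add: conj_mult)
    finally show "y \<otimes> c \<otimes> inv y = c \<otimes> inv z"
      using that by (metis in_carrier(3) inv_closed inv_solve_right m_closed)
  qed
  show "inv a \<otimes> c \<otimes> a = c \<otimes> d" "a \<otimes> c \<otimes> inv a = c \<otimes> inv d"
    using *[of a d] ca d_comm by auto
  show "inv b \<otimes> c \<otimes> b = c \<otimes> e" "b \<otimes> c \<otimes> inv b = c \<otimes> inv e"
    using *[of b e] cb e_comm by auto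
qed

text \<open>By \<open>conj_c\<close> the conjugates of \<open>c\<close> under \<open>a\<close> and
  \<open>b\<close> differ from \<open>c\<close> by \<open>d\<close>, \<open>e\<close> or their
  inverses, all of which lie in \<open>ext_de\<close>.\<close>

lemma normalizes_cde:
  shows "normalizes G a ext_cde" "normalizes G b ext_cde"
proof -
  have "c \<otimes> x \<in> ext_cde" "c \<otimes> inv x \<in> ext_cde" if "x \<in> ext_de" for x
    using that subgroup_cde c_in_cde de_subset_cde
    by (auto intro!: subgroup.m_closed subgroup.m_inv_closed)
  note * = this[OF d_in_de] this[OF e_in_de]
  show "normalizes G a ext_cde"
    by (rule normalizes_cyclic_extI[OF subgroup_de ext_cde_def subgroup_cde])
     (use * in \<open>simp_all add: conj_c normalizes_de e_comm d_comm\<close>)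
  show "normalizes G b ext_cde"
    by (rule normalizes_cyclic_extI[OF subgroup_de ext_cde_def subgroup_cde])
     (use * in \<open>simp_all add: conj_c normalizes_de e_comm d_comm\<close>)
qed

lemma subgroup_bcde: "subgroup ext_bcde G"
  unfolding ext_bcde_def
  by (intro subgroup_cyclic_ext subgroup_cde normalizes_cde) simp_all

lemma b_in_bcde: "b \<in> ext_bcde"
  unfolding ext_bcde_def by (intro in_cyclic_ext subgroup.one_closed subgroup_cde) simp

lemma cde_subset_bcde: "ext_cde \<subseteq> ext_bcde"
  unfolding ext_bcde_def by (intro subset_cyclic_ext subgroup.subset subgroup_cde)

text \<open>The first conjugate is left in terms of \<open>a c a^-1\<close>, which lies in
  \<open>ext_cde\<close> because \<open>a\<close> normalizes that subgroup; this suffices for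
  \<open>normalizes_bcde\<close>.\<close>

lemma conj_b:
  "a \<otimes> b \<otimes> inv a = b \<otimes> (a \<otimes> c \<otimes> inv a)" "inv a \<otimes> b \<otimes> a = b \<otimes> inv c"
proof -
  show "a \<otimes> b \<otimes> inv a = b \<otimes> (a \<otimes> c \<otimes> inv a)"
    by (simp add: ab m_assoc)
  have "b \<otimes> a = a \<otimes> b \<otimes> inv c" by (simp add: ab m_assoc)
  then show "inv a \<otimes> b \<otimes> a = b \<otimes> inv c"
    by (simp add: m_assoc mult_inv_cancel)
qed

lemma normalizes_bcde: "normalizes G a ext_bcde"
proof (rule normalizes_cyclic_extI[OF subgroup_cde ext_bcde_def subgroup_bcde])
  have "b \<otimes> x \<in> ext_bcde" if "x \<in> ext_cde" for x
    using that subgroup_bcde b_in_bcde cde_subset_bcde by (auto intro!: subgroup.m_closed)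
  moreover have "a \<otimes> c \<otimes> inv a \<in> ext_cde" "inv c \<in> ext_cde"
    using normalizes_cde c_in_cde subgroup_cde by (auto simp: normalizes_def subgroup.m_inv_closed)
  ultimately show "a \<otimes> b \<otimes> inv a \<in> ext_bcde" "inv a \<otimes> b \<otimes> a \<in> ext_bcde"
    by (simp_all only: conj_b)
qed (simp_all add: normalizes_cde)

lemma subgroup_abcde: "subgroup ext_abcde G"
  unfolding ext_abcde_def
  by (intro subgroup_cyclic_ext subgroup_bcde normalizes_bcde) simp_all

lemma a_in_abcde: "a \<in> ext_abcde"
  unfolding ext_abcde_def by (intro in_cyclic_ext subgroup.one_closed subgroup_bcde) simp

lemma bcde_subset_abcde: "ext_bcde \<subseteq> ext_abcde"
  unfolding ext_abcde_def by (intro subset_cyclic_ext subgroup.subset subgroup_bcde)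

lemma generate_subset_abcde: "generate G {a, b} \<subseteq> ext_abcde"
proof (rule generate_subgroup_incl[OF _ subgroup_abcde])
  show "{a, b} \<subseteq> ext_abcde"
    using a_in_abcde b_in_bcde bcde_subset_abcde by auto
qed

lemma ext_de_iff: "t \<in> ext_de \<longleftrightarrow> (\<exists>(j::int) (i::int). t = e [^] j \<otimes> d [^] i)"
proof -
  have e_iff: "t \<in> ext_e \<longleftrightarrow> (\<exists>j::int. t = e [^] j)" for t
    unfolding ext_e_def cyclic_ext_iff by auto
  then show ?thesis by (simp only: ext_de_def cyclic_ext_iff Bex_def e_iff) blast
qed

lemma ext_abcde_iff:
  "g \<in> ext_abcde \<longleftrightarrow> (\<exists>(j::int) (i::int) (z::int) (y::int) (x::int). g = e [^] j \<otimes> d [^] i \<otimes> c [^] z \<otimes> b [^] y \<otimes> a [^] x)"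
  by (simp only: ext_abcde_def ext_bcde_def ext_cde_def cyclic_ext_iff Bex_def ext_de_iff) blast

text \<open>The tower is climbed from the trivial subgroup by
  \<open>finite_cosets_cyclic_ext\<close>, one generator at a time. If its top is the whole group,
  \<open>K\<close> has finite index.\<close>

lemma finite_cosets_abcde:
  assumes K: "subgroup K G" and k: "k > 0"
    and "a [^] (k::nat) \<in> K" "b [^] k \<in> K" "c [^] k \<in> K" "d [^] k \<in> K" "e [^] k \<in> K"
  shows "finite ((\<lambda>x. K #> x) ` ext_abcde)"
proof -
  note fin = finite_cosets_cyclic_ext[OF K _ _ _ _ k]
  have "finite ((\<lambda>x. K #> x) ` ext_e)"
    unfolding ext_e_def by (rule fin) (use assms normalizes_one in auto)
  then have "finite ((\<lambda>x. K #> x) ` ext_de)"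
    unfolding ext_de_def
    by (intro fin) (use assms subgroup.subset[OF subgroup_e] in \<open>auto simp: normalizes_e e_comm\<close>)
  then have "finite ((\<lambda>x. K #> x) ` ext_cde)"
    unfolding ext_cde_def
    by (intro fin)
      (use assms subgroup.subset[OF subgroup_de] in \<open>auto simp: normalizes_de e_comm d_comm\<close>)
  then have "finite ((\<lambda>x. K #> x) ` ext_bcde)"
    unfolding ext_bcde_def
    by (intro fin) (use assms subgroup.subset[OF subgroup_cde] normalizes_cde in auto)
  then show ?thesis
    unfolding ext_abcde_def
    by (intro fin) (use assms subgroup.subset[OF subgroup_bcde] normalizes_bcde in auto)
qed

end

subsection \<open>Integer powers and divisibility\<close>

lemma hom_fst_DirProd: "fst \<in> hom (G \<times>\<times> H) G"
  by (rule homI) auto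

lemma hom_snd_DirProd: "snd \<in> hom (G \<times>\<times> H) H"
  by (rule homI) auto

lemma int_pow_DirProd:
  assumes "group G" "group H" "g \<in> carrier G" "h \<in> carrier H"
  shows "(g, h) [^]\<^bsub>G \<times>\<times> H\<^esub> (i::int) = (g [^]\<^bsub>G\<^esub> i, h [^]\<^bsub>H\<^esub> i)"
  using hom_int_pow[OF hom_fst_DirProd, of "(g, h)" G H i]
    hom_int_pow[OF hom_snd_DirProd, of "(g, h)" G H i] assms DirProd_group[OF assms(1,2)]
  by (metis SigmaI carrier_DirProd fst_conv prod.collapse snd_conv)

context group
begin

section \<open>Powers and normal forms in class two\<close>

lemma int_pow_commute:
  assumes "x \<in> carrier G" "y \<in> carrier G" "x \<otimes> y = y \<otimes> x"
  shows "x [^] (i::int) \<otimes> y = y \<otimes> x [^] i"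
proof -
  have "y \<otimes> x \<otimes> inv y = x" using assms by (metis inv_solve_right m_closed)
  then have "y \<otimes> x [^] i \<otimes> inv y = x [^] i" using assms by (simp add: conj_int_pow)
  then show ?thesis using assms by (metis inv_solve_right int_pow_closed m_closed)
qed

lemma int_pow_int_pow_commute:
  assumes "x \<in> carrier G" "y \<in> carrier G" "x \<otimes> y = y \<otimes> x"
  shows "x [^] (i::int) \<otimes> y [^] (j::int) = y [^] j \<otimes> x [^] i"
  using int_pow_commute[OF assms(2) int_pow_closed[OF assms(1)] int_pow_commute[OF assms, symmetric]]
  by simp

text \<open>Conjugation by \<open>v^-1\<close> maps \<open>u\<close> to \<open>u w\<close>, hence
  \<open>u^i\<close> to \<open>u^i w^i\<close>. Read the other way, conjugation by
  \<open>u^i\<close> maps \<open>v\<close> to \<open>v w^i\<close>, and the \<open>j\<close>-th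
  power of this gives the exponent \<open>i * j\<close>.\<close>

lemma int_pow_commutator:
  assumes in_carrier: "u \<in> carrier G" "v \<in> carrier G" "w \<in> carrier G"
    and uv: "u \<otimes> v = v \<otimes> u \<otimes> w" and wu: "w \<otimes> u = u \<otimes> w" and wv: "w \<otimes> v = v \<otimes> w"
  shows "u [^] (i::int) \<otimes> v [^] (j::int) = v [^] j \<otimes> u [^] i \<otimes> w [^] (i * j)"
proof -
  have "inv v \<otimes> u [^] i \<otimes> inv (inv v) = (inv v \<otimes> u \<otimes> inv (inv v)) [^] i"
    by (rule conj_int_pow) (use in_carrier in simp_all)
  also have "inv v \<otimes> u \<otimes> inv (inv v) = u \<otimes> w"
    using in_carrier uv by (simp add: m_assoc mult_inv_cancel)
  also have "(u \<otimes> w) [^] i = u [^] i \<otimes> w [^] i"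
    by (rule int_pow_mult_distrib) (use in_carrier wu in simp_all)
  finally have *: "inv v \<otimes> u [^] i \<otimes> v = u [^] i \<otimes> w [^] i"
    using in_carrier by simp
  have wi: "w [^] i \<otimes> u [^] i = u [^] i \<otimes> w [^] i"
    by (rule int_pow_int_pow_commute[OF in_carrier(3,1) wu])
  have "u [^] i \<otimes> v = v \<otimes> (inv v \<otimes> u [^] i \<otimes> v)"
    using in_carrier by (simp add: m_assoc mult_inv_cancel)
  also have "\<dots> = v \<otimes> w [^] i \<otimes> u [^] i"
    using * wi in_carrier by (simp add: m_assoc)
  finally have "u [^] i \<otimes> v \<otimes> inv (u [^] i) = v \<otimes> w [^] i"
    using in_carrier by (simp add: m_assoc)
  then have "u [^] i \<otimes> v [^] j \<otimes> inv (u [^] i) = (v \<otimes> w [^] i) [^] j"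
    using in_carrier by (simp add: conj_int_pow)
  also have "\<dots> = v [^] j \<otimes> w [^] (i * j)"
    using int_pow_mult_distrib[OF int_pow_commute[OF in_carrier(3,2) wv, symmetric]] in_carrier
    by (simp add: int_pow_pow)
  finally have "u [^] i \<otimes> v [^] j = v [^] j \<otimes> w [^] (i * j) \<otimes> u [^] i"
    using in_carrier by (metis inv_solve_right int_pow_closed m_closed)
  also have "v [^] j \<otimes> w [^] (i * j) \<otimes> u [^] i = v [^] j \<otimes> u [^] i \<otimes> w [^] (i * j)"
    using in_carrier int_pow_int_pow_commute[OF in_carrier(3,1) wu] by (simp add: m_assoc)
  finally show ?thesis .
qed

lemma int_pow_inject:
  assumes "x \<in> carrier G" "x [^] (i::int) = x [^] (j::int)" "\<And>k::int. x [^] k = \<one> \<Longrightarrow> k = 0"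
  shows "i = j"
proof -
  have "x [^] (i - j) = \<one>" using assms(1,2) by (simp add: int_pow_diff)
  then show ?thesis using assms(3) by fastforce
qed

text \<open>Commuting the normal form with \<open>v\<close> produces \<open>w^x\<close>, and
  commuting it with \<open>u\<close> produces \<open>w^y\<close>. Since distinct powers of
  \<open>w\<close> differ, the element determines \<open>x\<close> and \<open>y\<close>, and
  cancellation then determines \<open>z\<close>.\<close>

lemma class_2_exponents_unique:
  fixes x y z x' y' z' :: int
  assumes in_carrier: "u \<in> carrier G" "v \<in> carrier G" "w \<in> carrier G"
    and uv: "u \<otimes> v = v \<otimes> u \<otimes> w" and wu: "w \<otimes> u = u \<otimes> w" and wv: "w \<otimes> v = v \<otimes> w"
    and w: "\<And>k::int. w [^] k = \<one> \<Longrightarrow> k = 0"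
    and eq: "w [^] z \<otimes> v [^] y \<otimes> u [^] x = w [^] z' \<otimes> v [^] y' \<otimes> u [^] x'"
  shows "x = x'" "y = y'" "z = z'"
proof -
  note comm = int_pow_commutator[OF in_carrier uv wu wv]
  let ?g = "\<lambda>z y x. w [^] (z::int) \<otimes> v [^] (y::int) \<otimes> u [^] (x::int)"
  have R: "?g z y x \<otimes> v = v \<otimes> ?g z y x \<otimes> w [^] x" for z y x
  proof -
    have "u [^] x \<otimes> v = v \<otimes> u [^] x \<otimes> w [^] x" using comm[of x 1] in_carrier by simp
    moreover have "w [^] z \<otimes> v = v \<otimes> w [^] z" "v [^] y \<otimes> v = v \<otimes> v [^] y"
      by (intro int_pow_commute in_carrier wv refl)+
    ultimately show ?thesis
      using in_carrier by (smt (verit, ccfv_threshold) int_pow_closed m_assoc m_closed)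
  qed
  have L: "u \<otimes> ?g z y x = ?g z y x \<otimes> u \<otimes> w [^] y" for z y x
  proof -
    have "u \<otimes> v [^] y = v [^] y \<otimes> u \<otimes> w [^] y" using comm[of 1 y] in_carrier by simp
    moreover have "w [^] z \<otimes> u = u \<otimes> w [^] z" "u [^] x \<otimes> u = u \<otimes> u [^] x"
      "w [^] y \<otimes> u [^] x = u [^] x \<otimes> w [^] y" "w [^] y \<otimes> u = u \<otimes> w [^] y"
      by (intro int_pow_commute int_pow_int_pow_commute in_carrier wu refl)+
    ultimately show ?thesis
      using in_carrier by (smt (verit, ccfv_threshold) int_pow_closed m_assoc m_closed)
  qed
  have "v \<otimes> ?g z y x \<otimes> w [^] x = v \<otimes> ?g z y x \<otimes> w [^] x'"
    using R[of z y x] R[of z' y' x'] eq by simp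
  then have "w [^] x = w [^] x'" using in_carrier by simp
  then show x: "x = x'" using int_pow_inject in_carrier w by blast
  have "?g z y x \<otimes> u \<otimes> w [^] y = ?g z y x \<otimes> u \<otimes> w [^] y'"
    using L[of z y x] L[of z' y' x'] eq by simp
  then have "w [^] y = w [^] y'" using in_carrier by simp
  then show y: "y = y'" using int_pow_inject in_carrier w by blast
  have "w [^] z = w [^] z'" using eq x y in_carrier by simp
  then show "z = z'" using int_pow_inject in_carrier w by blast
qed

text \<open>Infinite descent on \<open>k\<close> in \<open>s^q = u^k\<close>: a \<open>p\<close>-th
  root \<open>r\<close> of \<open>s\<close> in \<open>S\<close> has \<open>r^q = u^l\<close> with
  \<open>k = l p\<close>, so the exponent shrinks until it is zero, where torsion-freeness applies.
  The exponent \<open>q\<close> covers sets that enter the cyclic group only after taking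
  \<open>q\<close>-th powers.\<close>

lemma divisible_over_cyclic_trivial:
  assumes tf: "\<And>x k::int. x \<in> carrier G \<Longrightarrow> k \<noteq> 0 \<Longrightarrow> x [^] k = \<one> \<Longrightarrow> x = \<one>"
    and u: "u \<in> carrier G" and S: "S \<subseteq> carrier G" and p: "p \<ge> (2::int)" and q: "q \<noteq> (0::int)"
    and div: "\<And>s. s \<in> S \<Longrightarrow> \<exists>r\<in>S. s = r [^] p"
    and pow: "\<And>s. s \<in> S \<Longrightarrow> \<exists>k::int. s [^] q = u [^] k"
  shows "S \<subseteq> {\<one>}"
proof (cases "u = \<one>")
  case True
  have "s = \<one>" if "s \<in> S" for s
    using pow[OF that] True tf[OF _ q, of s] S that by auto
  then show ?thesis by blast
next
  case False
  have inf: "k = 0" if "u [^] k = \<one>" for k :: int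
    using tf[OF u _ that] False by blast
  have "s = \<one>" if "s \<in> S" "s [^] q = u [^] k" for s and k :: int
    using that
  proof (induction "nat \<bar>k\<bar>" arbitrary: s k rule: less_induct)
    case less
    obtain r where r: "r \<in> S" "s = r [^] p" using div less.prems by blast
    obtain l where l: "r [^] q = u [^] (l::int)" using pow r by blast
    have rc: "r \<in> carrier G" "s \<in> carrier G" using r less.prems S by auto
    have "u [^] k = (r [^] q) [^] p"
      using less.prems(2) r(2) rc by (simp add: int_pow_pow mult.commute)
    also have "\<dots> = u [^] (l * p)" using l u by (simp add: int_pow_pow)
    finally have k: "k = l * p" using int_pow_inject u inf by blast
    show ?case
    proof (cases "l = 0")
      case True
      then show ?thesis using k less.prems(2) tf[OF rc(2) q] by simp
    next
      case False
      have "\<bar>l\<bar> * 1 < \<bar>l\<bar> * p" using p False by (intro mult_strict_left_mono) auto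
      then have "nat \<bar>l\<bar> < nat \<bar>k\<bar>" using k p by (simp add: abs_mult)
      then have "r = \<one>" using less.hyps r l by blast
      then show ?thesis using r by simp
    qed
  qed
  then show ?thesis using pow by blast
qed

text \<open>The generators may be linearly dependent; then the group they generate is, up to finite
  index, cyclic.\<close>

lemma divisible_over_two_generated_trivial:
  assumes tf: "\<And>x k::int. x \<in> carrier G \<Longrightarrow> k \<noteq> 0 \<Longrightarrow> x [^] k = \<one> \<Longrightarrow> x = \<one>"
    and u: "u \<in> carrier G" and v: "v \<in> carrier G" and uv: "u \<otimes> v = v \<otimes> u"
    and S: "\<And>s. s \<in> S \<Longrightarrow> \<exists>(i::int) (j::int). s = u [^] i \<otimes> v [^] j" and p: "p \<ge> (2::int)"
    and div: "\<And>s. s \<in> S \<Longrightarrow> \<exists>r\<in>S. s = r [^] p"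
  shows "S \<subseteq> {\<one>}"
proof -
  have Sc: "S \<subseteq> carrier G" using S u v by fastforce
  have comm: "u [^] i \<otimes> v [^] j = v [^] j \<otimes> u [^] i" for i j :: int
    by (rule int_pow_int_pow_commute[OF u v uv])
  have pow: "(u [^] i \<otimes> v [^] j) [^] k = u [^] (i * k) \<otimes> v [^] (j * k)" for i j k :: int
    using int_pow_mult_distrib[OF comm] u v by (simp add: int_pow_pow)
  have merge: "(u [^] i \<otimes> v [^] j) \<otimes> (u [^] k \<otimes> v [^] l) = u [^] (i + k) \<otimes> v [^] (j + l)"
    for i j k l :: int
  proof -
    have "(u [^] i \<otimes> v [^] j) \<otimes> (u [^] k \<otimes> v [^] l) = u [^] i \<otimes> (v [^] j \<otimes> u [^] k) \<otimes> v [^] l"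
      using u v by (simp add: m_assoc)
    also have "\<dots> = u [^] i \<otimes> (u [^] k \<otimes> v [^] j) \<otimes> v [^] l" by (simp only: comm)
    finally show ?thesis using u v by (simp add: m_assoc int_pow_mult)
  qed
  \<comment> \<open>A relation involving \<open>v\<close> reduces to the cyclic group of
    \<open>u\<close> with \<open>q = l\<close>. A relation in \<open>u\<close> alone forces
    \<open>u = \<one>\<close> and leaves the cyclic group of \<open>v\<close>. Otherwise exponents
    are unique, and the descent runs on both at once.\<close>
  consider (indep) "\<And>(i::int) (j::int). u [^] i \<otimes> v [^] j = \<one> \<Longrightarrow> i = 0 \<and> j = 0"
    | (dependent) k l :: int where "u [^] k \<otimes> v [^] l = \<one>" "l \<noteq> 0"
    | (torsion) k :: int where "u [^] k = \<one>" "k \<noteq> 0"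
  proof (cases "\<exists>(k::int) (l::int). u [^] k \<otimes> v [^] l = \<one> \<and> l \<noteq> 0")
    case True
    then show ?thesis using that(2) by blast
  next
    case False
    show ?thesis
    proof (cases "\<exists>k::int. u [^] k = \<one> \<and> k \<noteq> 0")
      case True
      then show ?thesis using that(3) by blast
    next
      case False': False
      show ?thesis
      proof (rule that(1))
        fix i j :: int assume *: "u [^] i \<otimes> v [^] j = \<one>"
        then have "j = 0" using False by blast
        then show "i = 0 \<and> j = 0" using * False' u by auto
      qed
    qed
  qed
  then show ?thesis
  proof cases
    case dep: (dependent k l)
    show ?thesis
    proof (rule divisible_over_cyclic_trivial[OF tf u Sc p dep(2) div])
      fix s assume "s \<in> S"
      then obtain i j :: int where s: "s = u [^] i \<otimes> v [^] j" using S by blast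
      have "s [^] l = u [^] (i * l) \<otimes> v [^] (j * l)" unfolding s by (rule pow)
      \<comment> \<open>The \<open>j\<close>-th power of the relation
        \<open>u^k v^l = \<one>\<close> is split off to cancel the exponent of
        \<open>v\<close>.\<close>
      also have "\<dots> = u [^] (i * l - k * j) \<otimes> v [^] (0::int) \<otimes> (u [^] (k * j) \<otimes> v [^] (l * j))"
        unfolding merge by (simp add: algebra_simps)
      also have "u [^] (k * j) \<otimes> v [^] (l * j) = \<one>"
        unfolding pow[symmetric] dep(1) by simp
      finally show "\<exists>k::int. s [^] l = u [^] k" using u by auto
    qed auto
  next
    case tor: (torsion k)
    then have "u = \<one>" using tf u by blast
    show ?thesis
    proof (rule divisible_over_cyclic_trivial[OF tf v Sc p _ div])
      fix s assume "s \<in> S"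
      then obtain i j :: int where s: "s = u [^] i \<otimes> v [^] j" using S by blast
      then have "s [^] (1::int) = v [^] j" using \<open>u = \<one>\<close> v by simp
      then show "\<exists>k::int. s [^] (1::int) = v [^] k" by blast
    qed auto
  next
    case indep
    have "s = \<one>" if "s \<in> S" "s = u [^] i \<otimes> v [^] j" for s and i j :: int
      using that
    proof (induction "nat (\<bar>i\<bar> + \<bar>j\<bar>)" arbitrary: s i j rule: less_induct)
      case less
      obtain r where r: "r \<in> S" "s = r [^] p" using div less.prems by blast
      obtain k l :: int where kl: "r = u [^] k \<otimes> v [^] l" using S r by blast
      have "u [^] i \<otimes> v [^] j = u [^] (k * p) \<otimes> v [^] (l * p)"
        using less.prems r kl pow by simp
      then have "\<one> = u [^] (k * p - i) \<otimes> v [^] (l * p - j)"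
        using merge[of i j "-i" "-j"] merge[of "k * p" "l * p" "-i" "-j"] by simp
      then have *: "i = k * p" "j = l * p" using indep by force+
      show ?case
      proof (cases "k = 0 \<and> l = 0")
        case True
        then show ?thesis using r kl by simp
      next
        case False
        have "(\<bar>k\<bar> + \<bar>l\<bar>) * 1 < (\<bar>k\<bar> + \<bar>l\<bar>) * p"
          using p False by (intro mult_strict_left_mono) auto
        then have "nat (\<bar>k\<bar> + \<bar>l\<bar>) < nat (\<bar>i\<bar> + \<bar>j\<bar>)"
          using * p by (simp add: abs_mult algebra_simps)
        then have "r = \<one>" using less.hyps r kl by blast
        then show ?thesis using r by simp
      qed
    qed
    then show ?thesis using S by blast
  qed
qed

text \<open>If \<open>g\<close> and \<open>g'\<close> lie over the same \<open>h\<close>, then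
  \<open>(g g'^-1, \<one>)\<close> is in \<open>\<Gamma>\<close>, so \<open>h \<mapsto> g\<close> is
  well defined. In the application \<open>\<Gamma>\<close> is the graph of the power endomorphism,
  and this map is its inverse.\<close>

lemma subgroup_graph_hom:
  assumes \<Gamma>: "subgroup \<Gamma> (G \<times>\<times> G)" and inj: "\<And>g. (g, \<one>) \<in> \<Gamma> \<Longrightarrow> g = \<one>"
  shows "subgroup (snd ` \<Gamma>) G"
    and "\<exists>f\<in>hom (G\<lparr>carrier := snd ` \<Gamma>\<rparr>) G. \<forall>g h. (g, h) \<in> \<Gamma> \<longrightarrow> f h = g"
proof -
  have \<Gamma>c: "\<Gamma> \<subseteq> carrier G \<times> carrier G" using subgroup.subset[OF \<Gamma>] by simp
  have mult: "(g \<otimes> g', h \<otimes> h') \<in> \<Gamma>" if "(g, h) \<in> \<Gamma>" "(g', h') \<in> \<Gamma>" for g g' h h'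
    using subgroup.m_closed[OF \<Gamma> that] by simp
  have inverse: "(inv g, inv h) \<in> \<Gamma>" if "(g, h) \<in> \<Gamma>" for g h
    using subgroup.m_inv_closed[OF \<Gamma> that] that \<Gamma>c is_group by (auto simp: subset_iff)
  show "subgroup (snd ` \<Gamma>) G"
  proof (rule subgroupI)
    show "snd ` \<Gamma> \<noteq> {}" using subgroup.one_closed[OF \<Gamma>] by blast
  qed (use \<Gamma>c mult inverse in force)+
  have unique: "g = g'" if *: "(g, h) \<in> \<Gamma>" "(g', h) \<in> \<Gamma>" for g g' h
  proof -
    have "(g \<otimes> inv g', \<one>) \<in> \<Gamma>" using mult[OF *(1) inverse[OF *(2)]] * \<Gamma>c by auto
    then have "g \<otimes> inv g' = \<one>" by (rule inj)
    then show ?thesis using * \<Gamma>c by (metis SigmaD1 inv_equality inv_inv inv_closed subsetD)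
  qed
  define f where "f h = (THE g. (g, h) \<in> \<Gamma>)" for h
  have f: "f h = g" if "(g, h) \<in> \<Gamma>" for g h
    unfolding f_def using that unique by (intro the_equality) auto
  moreover have "f \<in> hom (G\<lparr>carrier := snd ` \<Gamma>\<rparr>) G"
    by (rule homI) (use f mult \<Gamma>c in \<open>auto simp: subset_iff\<close>)
  ultimately show "\<exists>f\<in>hom (G\<lparr>carrier := snd ` \<Gamma>\<rparr>) G. \<forall>g h. (g, h) \<in> \<Gamma> \<longrightarrow> f h = g"
    by blast
qed

text \<open>Pigeonhole: two of the powers of \<open>x\<close> lie in the same coset of
  \<open>H\<close>, and their quotient is a positive power in \<open>H\<close>.\<close>

lemma finite_index_pow_mem:
  assumes H: "finite_index_subgroup H G" and x: "x \<in> carrier G"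
  obtains k :: nat where "k > 0" "x [^] k \<in> H"
proof -
  have sub: "subgroup H G" and fin: "finite (rcosets H)"
    using H unfolding finite_index_subgroup_def by auto
  have "\<not> inj (\<lambda>i::nat. H #> x [^] i)"
    using fin rcosetsI[OF subgroup.subset[OF sub]] x
    by (meson finite_subset image_subsetI infinite_UNIV_nat finite_imageD nat_pow_closed)
  then obtain i j :: nat where ij: "i < j" "H #> x [^] i = H #> x [^] j"
    unfolding inj_def by (metis linorder_neqE_nat)
  have "x [^] j = x [^] (j - i) \<otimes> x [^] i" using ij x by (simp add: nat_pow_mult)
  moreover have "x [^] j \<in> H #> x [^] i" using ij repr_independenceD[OF sub] x by simp
  then obtain h where "h \<in> H" "x [^] j = h \<otimes> x [^] i" unfolding r_coset_def by blast
  ultimately have "x [^] (j - i) \<in> H"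
    using x subgroup.mem_carrier[OF sub] by simp
  then show ?thesis using that[of "j - i"] ij by simp
qed

end

subsection \<open>Torsion-free groups of class three and their power endomorphisms\<close>

context class_3_tuple
begin

lemma d_in_abcde: "d \<in> ext_abcde" and e_in_abcde: "e \<in> ext_abcde"
  and c_in_abcde: "c \<in> ext_abcde" and b_in_abcde: "b \<in> ext_abcde"
  using d_in_de e_in_de de_subset_cde c_in_cde cde_subset_bcde b_in_bcde bcde_subset_abcde
  by auto

end

text \<open>\<open>nontrivial\<close> expresses that the class is not smaller than three. The
  elements \<open>d\<close> and \<open>e\<close> may be dependent, and one of them may be
  trivial.\<close>

locale torsion_free_class_3 = class_3_tuple +
  assumes generated: "generate G {a, b} = carrier G"
    and torsion_free: "x \<in> carrier G \<Longrightarrow> k \<noteq> 0 \<Longrightarrow> x [^] (k::int) = \<one> \<Longrightarrow> x = \<one>"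
    and d_central: "x \<in> carrier G \<Longrightarrow> d \<otimes> x = x \<otimes> d"
    and e_central: "x \<in> carrier G \<Longrightarrow> e \<otimes> x = x \<otimes> e"
    and nontrivial: "d \<noteq> \<one> \<or> e \<noteq> \<one>"
begin

lemma ext_abcde_eq: "ext_abcde = carrier G"
  using generate_subset_abcde generated subgroup.subset[OF subgroup_abcde] by simp

lemma de_subset_carrier: "ext_de \<subseteq> carrier G"
  by (rule subgroup.subset[OF subgroup_de])

lemma de_central:
  assumes "t \<in> ext_de" "x \<in> carrier G"
  shows "t \<otimes> x = x \<otimes> t"
proof -
  obtain i j :: int where t: "t = e [^] j \<otimes> d [^] i" using assms(1) ext_de_iff by blast
  have e: "e [^] j \<otimes> x = x \<otimes> e [^] j" and d: "d [^] i \<otimes> x = x \<otimes> d [^] i"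
    by (intro int_pow_commute in_carrier assms d_central e_central)+
  have "t \<otimes> x = e [^] j \<otimes> (x \<otimes> d [^] i)" using t d assms by (simp add: m_assoc)
  also have "\<dots> = x \<otimes> t" using t e assms by (simp flip: m_assoc)
  finally show ?thesis .
qed

lemma de_normal: "ext_de \<lhd> G"
  unfolding normal_inv_iff
proof (intro conjI ballI subgroup_de)
  fix x t assume x: "x \<in> carrier G" and t: "t \<in> ext_de"
  then have "x \<otimes> t \<otimes> inv x = t"
    by (intro conj_commuting de_central) (use de_subset_carrier in auto)
  then show "x \<otimes> t \<otimes> inv x \<in> ext_de" using t by simp
qed

text \<open>Elements of \<open>ext_de\<close> are central, so the commutators \<open>d^k\<close> and
  \<open>e^k\<close> of \<open>c^k\<close> with \<open>a\<close> and \<open>b\<close> are trivial.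
  For \<open>k \<noteq> 0\<close> torsion-freeness gives \<open>d = e = \<one>\<close>, against
  \<open>nontrivial\<close>.\<close>

lemma c_pow_in_de:
  assumes "c [^] (k::int) \<in> ext_de"
  shows "k = 0"
proof (rule ccontr)
  assume k: "k \<noteq> 0"
  have "z = \<one>" if y: "y \<in> carrier G" and z: "z \<in> carrier G" "z \<otimes> c = c \<otimes> z" "z \<otimes> y = y \<otimes> z"
    and cy: "c \<otimes> y = y \<otimes> c \<otimes> z" for y z
  proof -
    have "c [^] k \<otimes> y = y \<otimes> c [^] k \<otimes> z [^] k"
      using int_pow_commutator[OF in_carrier(3) y z(1) cy z(2,3), of k 1] y by simp
    moreover have "c [^] k \<otimes> y = y \<otimes> c [^] k" using de_central assms y by blast
    ultimately have "y \<otimes> c [^] k \<otimes> z [^] k = y \<otimes> c [^] k" by simp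
    then have "z [^] k = \<one>" using l_cancel_one y z(1) by (metis in_carrier(3) int_pow_closed m_closed)
    then show ?thesis using torsion_free k z(1) by blast
  qed
  from this[of a d] this[of b e] show False
    using nontrivial ca cb d_comm e_comm by auto
qed

section \<open>The quotient by \<open>ext_de\<close> and uniqueness of normal forms\<close>

lemma coset_eq_iff:
  assumes "x \<in> carrier G" "y \<in> carrier G"
  shows "ext_de #> x = ext_de #> y \<longleftrightarrow> (\<exists>t\<in>ext_de. x = t \<otimes> y)"
proof -
  have "ext_de #> x = ext_de #> y \<longleftrightarrow> x \<in> ext_de #> y"
    using repr_independence[OF _ assms(2) subgroup_de] repr_independenceD[OF subgroup_de assms(1)]
    by metis
  then show ?thesis by (simp add: r_coset_def)
qed

sublocale quotient: group "G Mod ext_de"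
  by (rule normal.factorgroup_is_group[OF de_normal])

abbreviation "proj \<equiv> \<lambda>x. ext_de #> x"

lemma proj_hom: "proj \<in> hom G (G Mod ext_de)"
  by (rule normal.r_coset_hom_Mod[OF de_normal])

lemma proj_mult: "x \<in> carrier G \<Longrightarrow> y \<in> carrier G \<Longrightarrow> proj (x \<otimes> y) = proj x \<otimes>\<^bsub>G Mod ext_de\<^esub> proj y"
  by (rule hom_mult[OF proj_hom])

lemma proj_pow: "x \<in> carrier G \<Longrightarrow> proj (x [^] (i::int)) = proj x [^]\<^bsub>G Mod ext_de\<^esub> i"
  by (rule hom_int_pow[OF proj_hom]) (auto intro: is_group quotient.is_group)

lemma proj_closed: "x \<in> carrier G \<Longrightarrow> proj x \<in> carrier (G Mod ext_de)"
  by (rule hom_in_carrier[OF proj_hom])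

lemma proj_de: "t \<in> ext_de \<Longrightarrow> proj t = \<one>\<^bsub>G Mod ext_de\<^esub>"
  using coset_join2[OF _ subgroup_de] de_subset_carrier by auto

text \<open>Modulo \<open>ext_de\<close> the factors \<open>d\<close> and \<open>e\<close> vanish,
  so the class-two lemmas apply to the images of \<open>a\<close>, \<open>b\<close>,
  \<open>c\<close>.\<close>

lemma proj_relations:
  "proj a \<otimes>\<^bsub>G Mod ext_de\<^esub> proj b = proj b \<otimes>\<^bsub>G Mod ext_de\<^esub> proj a \<otimes>\<^bsub>G Mod ext_de\<^esub> proj c"
  "proj c \<otimes>\<^bsub>G Mod ext_de\<^esub> proj a = proj a \<otimes>\<^bsub>G Mod ext_de\<^esub> proj c"
  "proj c \<otimes>\<^bsub>G Mod ext_de\<^esub> proj b = proj b \<otimes>\<^bsub>G Mod ext_de\<^esub> proj c"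
proof -
  show "proj a \<otimes>\<^bsub>G Mod ext_de\<^esub> proj b = proj b \<otimes>\<^bsub>G Mod ext_de\<^esub> proj a \<otimes>\<^bsub>G Mod ext_de\<^esub> proj c"
    by (simp only: proj_mult[symmetric] in_carrier m_closed ab)
  have "proj (x \<otimes> t) = proj x" if "x \<in> carrier G" "t \<in> ext_de" for x t
    using coset_eq_iff[of "x \<otimes> t" x] de_central[OF that(2,1)] that de_subset_carrier
    by (metis m_closed subsetD)
  then show "proj c \<otimes>\<^bsub>G Mod ext_de\<^esub> proj a = proj a \<otimes>\<^bsub>G Mod ext_de\<^esub> proj c"
    "proj c \<otimes>\<^bsub>G Mod ext_de\<^esub> proj b = proj b \<otimes>\<^bsub>G Mod ext_de\<^esub> proj c"
    by (simp_all only: proj_mult[symmetric] in_carrier m_closed ca cb d_in_de e_in_de)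
qed

lemma proj_c_pow:
  assumes "proj c [^]\<^bsub>G Mod ext_de\<^esub> (k::int) = \<one>\<^bsub>G Mod ext_de\<^esub>"
  shows "k = 0"
proof (rule c_pow_in_de)
  have "proj (c [^] k) = ext_de" using assms by (simp add: proj_pow)
  then show "c [^] k \<in> ext_de" using coset_join1 subgroup_de by simp
qed

lemmas proj_commutator = quotient.int_pow_commutator[OF proj_closed proj_closed proj_closed
    proj_relations, OF in_carrier(1-3)]

text \<open>Projection removes \<open>t\<close>, uniqueness in class two gives \<open>x\<close>,
  \<open>y\<close>, \<open>z\<close>, and \<open>t\<close> follows by cancellation. The central part
  is kept as one element because exponents of \<open>d\<close> and \<open>e\<close> may fail to be
  unique.\<close>

lemma exponents_unique:
  fixes x y z x' y' z' :: int
  assumes t: "t \<in> ext_de" "t' \<in> ext_de"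
    and eq: "t \<otimes> c [^] z \<otimes> b [^] y \<otimes> a [^] x = t' \<otimes> c [^] z' \<otimes> b [^] y' \<otimes> a [^] x'"
  shows "x = x' \<and> y = y' \<and> z = z' \<and> t = t'"
proof -
  have tc: "t \<in> carrier G" "t' \<in> carrier G" using t de_subset_carrier by auto
  have "proj (s \<otimes> c [^] z \<otimes> b [^] y \<otimes> a [^] x) = proj c [^]\<^bsub>G Mod ext_de\<^esub> z
      \<otimes>\<^bsub>G Mod ext_de\<^esub> proj b [^]\<^bsub>G Mod ext_de\<^esub> y \<otimes>\<^bsub>G Mod ext_de\<^esub> proj a [^]\<^bsub>G Mod ext_de\<^esub> x"
    if "s \<in> ext_de" for s and x y z :: int
  proof -
    have s: "s \<in> carrier G" using that de_subset_carrier by blast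
    show ?thesis
      by (simp only: proj_mult proj_pow in_carrier s m_closed int_pow_closed proj_de[OF that]
          quotient.l_one quotient.int_pow_closed proj_closed)
  qed
  from this[OF t(1), of z y x] this[OF t(2), of z' y' x']
  have "proj c [^]\<^bsub>G Mod ext_de\<^esub> z
      \<otimes>\<^bsub>G Mod ext_de\<^esub> proj b [^]\<^bsub>G Mod ext_de\<^esub> y \<otimes>\<^bsub>G Mod ext_de\<^esub> proj a [^]\<^bsub>G Mod ext_de\<^esub> x =
    proj c [^]\<^bsub>G Mod ext_de\<^esub> z'
      \<otimes>\<^bsub>G Mod ext_de\<^esub> proj b [^]\<^bsub>G Mod ext_de\<^esub> y' \<otimes>\<^bsub>G Mod ext_de\<^esub> proj a [^]\<^bsub>G Mod ext_de\<^esub> x'"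
    using eq by simp
  note * = quotient.class_2_exponents_unique[OF proj_closed proj_closed proj_closed
    proj_relations proj_c_pow this, OF in_carrier(1-3)]
  then have "x = x'" "y = y'" "z = z'" by auto
  then show ?thesis using eq tc by simp
qed

text \<open>In the quotient the commutator of \<open>a^n\<close> and \<open>b^n\<close> is
  \<open>c^(n*n)\<close>; in \<open>G\<close> it is this power times some \<open>t\<close> in
  \<open>ext_de\<close>, whose value is left open.\<close>

lemma commutator_pow:
  fixes n :: int
  obtains t where "t \<in> ext_de" "a [^] n \<otimes> b [^] n = b [^] n \<otimes> a [^] n \<otimes> (t \<otimes> c [^] (n * n))"
proof -
  have "proj (a [^] n \<otimes> b [^] n) = proj (b [^] n \<otimes> a [^] n \<otimes> c [^] (n * n))"
    using proj_commutator[of n n]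
    by (simp only: proj_mult proj_pow in_carrier m_closed int_pow_closed)
  then obtain t where t: "t \<in> ext_de" "a [^] n \<otimes> b [^] n = t \<otimes> (b [^] n \<otimes> a [^] n \<otimes> c [^] (n * n))"
    using coset_eq_iff by auto
  moreover have "t \<otimes> (b [^] n \<otimes> a [^] n \<otimes> c [^] (n * n)) = b [^] n \<otimes> a [^] n \<otimes> (t \<otimes> c [^] (n * n))"
    using de_central[OF t(1), of "b [^] n \<otimes> a [^] n"] t(1) de_subset_carrier
    by (simp add: m_assoc[symmetric] subset_iff)
  ultimately show ?thesis using that by simp
qed

text \<open>The subgroup generated by this tuple is the graph of the endomorphism given by
  \<open>a \<mapsto> a\<^sup>n\<close> and \<open>b \<mapsto> b\<^sup>n\<close>.\<close>

lemma power_tuple: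
  fixes n :: int
  assumes t: "t \<in> ext_de" "a [^] n \<otimes> b [^] n = b [^] n \<otimes> a [^] n \<otimes> (t \<otimes> c [^] (n * n))"
  shows "class_3_tuple (G \<times>\<times> G) (a, a [^] n) (b, b [^] n) (c, t \<otimes> c [^] (n * n))
    (d, d [^] (n * n * n)) (e, e [^] (n * n * n))"
proof -
  have tc: "t \<in> carrier G" using t(1) de_subset_carrier by blast
  \<comment> \<open>\<open>(y, z)\<close> stands for \<open>(a, d)\<close> and
    \<open>(b, e)\<close>. As \<open>t\<close> is central, only \<open>c^(n*n)\<close> and
    \<open>y^n\<close> contribute to the commutator, whence the exponent
    \<open>n*n*n\<close>.\<close>
  have comm: "t \<otimes> c [^] (n * n) \<otimes> y [^] n = y [^] n \<otimes> (t \<otimes> c [^] (n * n)) \<otimes> z [^] (n * n * n)"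
    if y: "y \<in> carrier G" and z: "z \<in> carrier G" "z \<otimes> c = c \<otimes> z" "z \<otimes> y = y \<otimes> z"
    and cy: "c \<otimes> y = y \<otimes> c \<otimes> z" for y z
  proof -
    have "t \<otimes> c [^] (n * n) \<otimes> y [^] n = t \<otimes> (y [^] n \<otimes> c [^] (n * n) \<otimes> z [^] (n * n * n))"
      using int_pow_commutator[OF in_carrier(3) y z(1) cy z(2,3), of "n * n" n] y tc
      by (simp add: m_assoc)
    also have "\<dots> = t \<otimes> y [^] n \<otimes> c [^] (n * n) \<otimes> z [^] (n * n * n)"
      using y z tc by (simp add: m_assoc)
    also have "t \<otimes> y [^] n = y [^] n \<otimes> t" using de_central t(1) y by blast
    finally show ?thesis using y z tc by (simp add: m_assoc)
  qed
  have d: "d [^] i \<otimes> x = x \<otimes> d [^] i" and e: "e [^] i \<otimes> x = x \<otimes> e [^] i"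
    if "x \<in> carrier G" for x and i :: int
    by (intro int_pow_commute in_carrier that d_central e_central)+
  have D: "(d, d [^] i) \<otimes>\<^bsub>G \<times>\<times> G\<^esub> (x, y) = (x, y) \<otimes>\<^bsub>G \<times>\<times> G\<^esub> (d, d [^] i)"
    and E: "(e, e [^] i) \<otimes>\<^bsub>G \<times>\<times> G\<^esub> (x, y) = (x, y) \<otimes>\<^bsub>G \<times>\<times> G\<^esub> (e, e [^] i)"
    if "x \<in> carrier G" "y \<in> carrier G" for x y and i :: int
    by (simp_all only: mult_DirProd d[OF that(2)] e[OF that(2)] d_central[OF that(1)]
        e_central[OF that(1)])
  interpret P: group "G \<times>\<times> G" by (rule DirProd_group) (rule is_group)+
  show ?thesis
  proof unfold_locales
    show "(c, t \<otimes> c [^] (n * n)) \<otimes>\<^bsub>G \<times>\<times> G\<^esub> (a, a [^] n) =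
      (a, a [^] n) \<otimes>\<^bsub>G \<times>\<times> G\<^esub> (c, t \<otimes> c [^] (n * n)) \<otimes>\<^bsub>G \<times>\<times> G\<^esub> (d, d [^] (n * n * n))"
      using comm[of a d] ca d_comm by simp
    show "(c, t \<otimes> c [^] (n * n)) \<otimes>\<^bsub>G \<times>\<times> G\<^esub> (b, b [^] n) =
      (b, b [^] n) \<otimes>\<^bsub>G \<times>\<times> G\<^esub> (c, t \<otimes> c [^] (n * n)) \<otimes>\<^bsub>G \<times>\<times> G\<^esub> (e, e [^] (n * n * n))"
      using comm[of b e] cb e_comm by simp
    show "(a, a [^] n) \<otimes>\<^bsub>G \<times>\<times> G\<^esub> (b, b [^] n) =
      (b, b [^] n) \<otimes>\<^bsub>G \<times>\<times> G\<^esub> (a, a [^] n) \<otimes>\<^bsub>G \<times>\<times> G\<^esub> (c, t \<otimes> c [^] (n * n))"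
      by (simp only: mult_DirProd ab t(2))
  qed ((rule D E; simp add: tc) | simp add: tc)+
qed

end

text \<open>\<open>w\<close> is the commutator of \<open>u\<close> and \<open>v\<close>. This puts
  the remaining generators of \<open>K\<close> into \<open>H\<close> once \<open>a^n\<close> and
  \<open>b^n\<close> are there.\<close>

lemma (in group) mem_subgroup_of_commutator:
  assumes "subgroup H G" "u \<in> H" "v \<in> H" "w \<in> carrier G" "u \<otimes> v = v \<otimes> u \<otimes> w"
  shows "w \<in> H"
proof -
  have c: "u \<in> carrier G" "v \<in> carrier G" using assms subgroup.mem_carrier by metis+
  have "w = inv (v \<otimes> u) \<otimes> (u \<otimes> v)"
    using assms(5) c assms(4) by (simp add: m_assoc mult_inv_cancel inv_mult_group)
  then show ?thesis
    using assms(1-3) subgroup.m_closed subgroup.m_inv_closed by metis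
qed

context torsion_free_class_3
begin

section \<open>The inverse of the power endomorphism\<close>

lemma divisible_subset_de_trivial:
  assumes "S \<subseteq> ext_de" "p \<ge> (2::int)" "\<And>s. s \<in> S \<Longrightarrow> \<exists>r\<in>S. s = r [^] p"
  shows "S \<subseteq> {\<one>}"
  by (rule divisible_over_two_generated_trivial[OF torsion_free in_carrier(5,4) e_comm(4) _ assms(2,3)])
    (use assms(1) in \<open>auto simp: ext_de_iff subset_iff\<close>)

text \<open>By \<open>div\<close>, each \<open>h\<close> in \<open>N\<close> arises from an element
  of \<open>N\<close> by multiplying the exponents of \<open>a\<close>, \<open>b\<close>,
  \<open>c\<close> by \<open>n\<close>, \<open>n\<close>, \<open>n*n\<close>, with any central part.
  As exponents are unique, this permits infinite descent on \<open>|x| + |y| + |z|\<close>.\<close>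

lemma exponents_zero:
  fixes n :: int
  assumes n: "n \<ge> 2"
    and div: "\<And>h. h \<in> N \<Longrightarrow> \<exists>s\<in>ext_de. \<exists>t\<in>ext_de. \<exists>(z::int) (y::int) (x::int).
      s \<otimes> c [^] z \<otimes> b [^] y \<otimes> a [^] x \<in> N \<and>
      h = t \<otimes> c [^] (n * n * z) \<otimes> b [^] (n * y) \<otimes> a [^] (n * x)"
    and "s \<in> ext_de" "s \<otimes> c [^] (z::int) \<otimes> b [^] (y::int) \<otimes> a [^] (x::int) \<in> N"
  shows "x = 0 \<and> y = 0 \<and> z = 0"
  using assms(3,4)
proof (induction "nat (\<bar>x\<bar> + \<bar>y\<bar> + \<bar>z\<bar>)" arbitrary: s x y z rule: less_induct)
  case less
  obtain s' t and z' y' x' :: int where st: "s' \<in> ext_de" "t \<in> ext_de"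
    and N: "s' \<otimes> c [^] z' \<otimes> b [^] y' \<otimes> a [^] x' \<in> N"
    and eq: "s \<otimes> c [^] z \<otimes> b [^] y \<otimes> a [^] x =
      t \<otimes> c [^] (n * n * z') \<otimes> b [^] (n * y') \<otimes> a [^] (n * x')"
    using div[OF less.prems(2)] by blast
  have xyz: "x = n * x'" "y = n * y'" "z = n * n * z'"
    using exponents_unique[OF less.prems(1) st(2) eq] by auto
  show ?case
  proof (cases "x' = 0 \<and> y' = 0 \<and> z' = 0")
    case True
    then show ?thesis using xyz by simp
  next
    case False
    have "(\<bar>x'\<bar> + \<bar>y'\<bar> + \<bar>z'\<bar>) * 1 < (\<bar>x'\<bar> + \<bar>y'\<bar> + \<bar>z'\<bar>) * n"
      using n False by (intro mult_strict_left_mono) auto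
    also have "\<dots> = n * \<bar>x'\<bar> + n * \<bar>y'\<bar> + n * 1 * \<bar>z'\<bar>"
      by (simp add: algebra_simps)
    also have "\<dots> \<le> n * \<bar>x'\<bar> + n * \<bar>y'\<bar> + n * n * \<bar>z'\<bar>"
      using n by (intro add_left_mono mult_right_mono mult_left_mono) auto
    also have "\<dots> = \<bar>x\<bar> + \<bar>y\<bar> + \<bar>z\<bar>"
      using xyz n by (simp add: abs_mult)
    finally have "\<bar>x'\<bar> + \<bar>y'\<bar> + \<bar>z'\<bar> < \<bar>x\<bar> + \<bar>y\<bar> + \<bar>z\<bar>" by simp
    then have "nat (\<bar>x'\<bar> + \<bar>y'\<bar> + \<bar>z'\<bar>) < nat (\<bar>x\<bar> + \<bar>y\<bar> + \<bar>z\<bar>)" by simp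
    from less.hyps[OF this st(1) N] False show ?thesis by blast
  qed
qed

text \<open>\<open>K\<close> is the image of the power endomorphism and \<open>f\<close> its
  inverse. Surjectivity of \<open>f\<close> is the existence of normal forms, well-definedness comes
  from their uniqueness and torsion-freeness, and simplicity from descent, first on the exponents
  and then in \<open>ext_de\<close>.\<close>

lemma self_similarity_witness:
  fixes n :: int
  assumes H: "subgroup H G" and n: "n \<ge> 2" and anH: "a [^] n \<in> H" and bnH: "b [^] n \<in> H"
  obtains K f where "subgroup K G" "K \<subseteq> H" "finite (rcosets K)"
    "f \<in> hom (G\<lparr>carrier := K\<rparr>) G" "f ` K = carrier G"
    "\<And>N. N \<lhd> G \<Longrightarrow> N \<subseteq> K \<Longrightarrow> f ` N \<subseteq> N \<Longrightarrow> N = {\<one>}"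
proof -
  obtain t where t: "t \<in> ext_de"
    and abn: "a [^] n \<otimes> b [^] n = b [^] n \<otimes> a [^] n \<otimes> (t \<otimes> c [^] (n * n))"
    using commutator_pow by blast
  have tc: "t \<in> carrier G" using t de_subset_carrier by blast
  define c' where "c' = t \<otimes> c [^] (n * n)"
  define p where "p = n * n * n"
  have c'c: "c' \<in> carrier G" unfolding c'_def using tc by simp
  interpret P: class_3_tuple "G \<times>\<times> G" "(a, a [^] n)" "(b, b [^] n)" "(c, c')" "(d, d [^] p)" "(e, e [^] p)"
    unfolding c'_def p_def by (rule power_tuple[OF t abn])
  define \<Gamma> where "\<Gamma> = P.ext_abcde"
  have \<Gamma>: "subgroup \<Gamma> (G \<times>\<times> G)" unfolding \<Gamma>_def by (rule P.subgroup_abcde)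
  have \<Gamma>_iff: "(g, h) \<in> \<Gamma> \<longleftrightarrow> (\<exists>(j::int) (i::int) (z::int) (y::int) (x::int).
      g = e [^] j \<otimes> d [^] i \<otimes> c [^] z \<otimes> b [^] y \<otimes> a [^] x \<and>
      h = (e [^] p) [^] j \<otimes> (d [^] p) [^] i \<otimes> c' [^] z \<otimes> (b [^] n) [^] y \<otimes> (a [^] n) [^] x)" for g h
    unfolding \<Gamma>_def P.ext_abcde_iff
    by (simp only: int_pow_DirProd[OF is_group is_group] in_carrier int_pow_closed c'c
        mult_DirProd prod.inject)
  \<comment> \<open>The part \<open>s\<close> in \<open>ext_de\<close> is raised to the power
    \<open>p\<close>, and \<open>c'^z\<close> contributes the extra central factor
    \<open>t^z\<close>.\<close>
  have \<Gamma>_normal_form: "\<exists>s\<in>ext_de. \<exists>(z::int) (y::int) (x::int).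
      g = s \<otimes> c [^] z \<otimes> b [^] y \<otimes> a [^] x \<and>
      h = s [^] p \<otimes> t [^] z \<otimes> c [^] (n * n * z) \<otimes> b [^] (n * y) \<otimes> a [^] (n * x)"
    if "(g, h) \<in> \<Gamma>" for g h
  proof -
    obtain j i z y x :: int where g: "g = e [^] j \<otimes> d [^] i \<otimes> c [^] z \<otimes> b [^] y \<otimes> a [^] x"
      and h: "h = (e [^] p) [^] j \<otimes> (d [^] p) [^] i \<otimes> c' [^] z \<otimes> (b [^] n) [^] y \<otimes> (a [^] n) [^] x"
      using \<open>(g, h) \<in> \<Gamma>\<close> \<Gamma>_iff by blast
    have "(e [^] p) [^] j \<otimes> (d [^] p) [^] i = (e [^] j) [^] p \<otimes> (d [^] i) [^] p"
      by (simp add: int_pow_pow mult.commute)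
    also have "\<dots> = (e [^] j \<otimes> d [^] i) [^] p"
      using int_pow_mult_distrib[OF int_pow_int_pow_commute[OF in_carrier(5,4) e_comm(4)]] by simp
    moreover have "c' [^] z = t [^] z \<otimes> c [^] (n * n * z)"
      unfolding c'_def using int_pow_mult_distrib[OF de_central[OF t]] tc by (simp add: int_pow_pow)
    ultimately have "h = (e [^] j \<otimes> d [^] i) [^] p \<otimes> t [^] z \<otimes> c [^] (n * n * z) \<otimes> b [^] (n * y) \<otimes> a [^] (n * x)"
      using h tc by (simp add: int_pow_pow m_assoc)
    then show ?thesis using g ext_de_iff by blast
  qed
  have de_pow: "s [^] (k::int) \<in> ext_de" if "s \<in> ext_de" for s k
    using subgroup_int_pow_closed[OF subgroup_de that] .
  have de_mult: "s [^] p \<otimes> t [^] (k::int) \<in> ext_de" if "s \<in> ext_de" for s k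
    using subgroup.m_closed[OF subgroup_de de_pow[OF that] de_pow[OF t]] .
  have p: "p \<ge> 2"
  proof -
    have "2 * 1 \<le> n * n" using n by (intro mult_mono) auto
    then have "2 * 1 \<le> n * n * n" using n by (intro mult_mono) auto
    then show ?thesis unfolding p_def by simp
  qed
  \<comment> \<open>Comparison with the normal form of \<open>\<one>\<close> makes \<open>x\<close>,
    \<open>y\<close>, \<open>z\<close> vanish; then \<open>s^p = \<one>\<close> forces
    \<open>s = \<one>\<close>.\<close>
  have inj: "g = \<one>" if g1: "(g, \<one>) \<in> \<Gamma>" for g
  proof -
    obtain s and z y x :: int where s: "s \<in> ext_de" and g: "g = s \<otimes> c [^] z \<otimes> b [^] y \<otimes> a [^] x"
      and eq: "\<one> = s [^] p \<otimes> t [^] z \<otimes> c [^] (n * n * z) \<otimes> b [^] (n * y) \<otimes> a [^] (n * x)"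
      using \<Gamma>_normal_form[OF g1] by blast
    have sc: "s \<in> carrier G" using s de_subset_carrier by blast
    have "\<one> \<otimes> c [^] (0::int) \<otimes> b [^] (0::int) \<otimes> a [^] (0::int) =
        s [^] p \<otimes> t [^] z \<otimes> c [^] (n * n * z) \<otimes> b [^] (n * y) \<otimes> a [^] (n * x)"
      using eq[symmetric] by simp
    note * = exponents_unique[OF subgroup.one_closed[OF subgroup_de] de_mult[OF s] this]
    then have xyz: "x = 0" "y = 0" "z = 0" using n by auto
    then have "s [^] p = \<one>" using * sc by simp
    then have "s = \<one>" using torsion_free[OF sc, of p] p by simp
    then show ?thesis using g xyz by simp
  qed
  define K where "K = snd ` \<Gamma>"
  have K: "subgroup K G" unfolding K_def using subgroup_graph_hom(1)[OF \<Gamma> inj] .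
  obtain f where f: "f \<in> hom (G\<lparr>carrier := K\<rparr>) G" and f_eq: "\<And>g h. (g, h) \<in> \<Gamma> \<Longrightarrow> f h = g"
    unfolding K_def using subgroup_graph_hom(2)[OF \<Gamma> inj] by blast
  have gens: "a [^] n \<in> K" "b [^] n \<in> K" "c' \<in> K" "d [^] p \<in> K" "e [^] p \<in> K"
    using P.a_in_abcde P.b_in_abcde P.c_in_abcde P.d_in_abcde P.e_in_abcde
    unfolding K_def \<Gamma>_def by force+
  have "K \<subseteq> H"
  proof
    have c'H: "c' \<in> H"
      by (rule mem_subgroup_of_commutator[OF H anH bnH c'c]) (use abn c'_def in simp)
    have dH: "d [^] p \<in> H"
      by (rule mem_subgroup_of_commutator[OF H c'H anH]) (use P.ca in simp_all)
    have eH: "e [^] p \<in> H"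
      by (rule mem_subgroup_of_commutator[OF H c'H bnH]) (use P.cb in simp_all)
    fix h assume "h \<in> K"
    then obtain g where "(g, h) \<in> \<Gamma>" unfolding K_def by force
    then show "h \<in> H"
      unfolding \<Gamma>_iff using H anH bnH c'H dH eH
      by (auto intro!: subgroup.m_closed subgroup_int_pow_closed)
  qed
  moreover have "finite (rcosets K)"
  proof -
    \<comment> \<open>\<open>m\<close> is a multiple of \<open>n\<close> and of \<open>p\<close>,
      which handles \<open>a\<close>, \<open>b\<close>, \<open>d\<close>, \<open>e\<close>. For
      \<open>c\<close> it is the exponent in \<open>c'^p = t^p c^(n*n*p)\<close>, where
      \<open>t^p\<close> lies in \<open>K\<close> because \<open>d^p\<close> and \<open>e^p\<close>
      do.\<close>
    define m where "m = n * n * p"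
    have m: "m > 0" unfolding m_def using n p by auto
    have Kpow: "x [^] nat m \<in> K" if "x \<in> carrier G" "x [^] k \<in> K" "m = k * l" for x and k l :: int
    proof -
      have "x [^] m = (x [^] k) [^] l" using that by (simp add: int_pow_pow)
      then have "x [^] m \<in> K" using subgroup_int_pow_closed[OF K that(2)] by simp
      then show ?thesis using m by (simp add: pow_nat)
    qed
    have "t [^] p \<in> K"
    proof -
      obtain i j :: int where "t = e [^] j \<otimes> d [^] i" using t ext_de_iff by blast
      then have "t [^] p = (e [^] j) [^] p \<otimes> (d [^] i) [^] p"
        using int_pow_mult_distrib[OF int_pow_int_pow_commute[OF in_carrier(5,4) e_comm(4)]] by simp
      also have "\<dots> = (e [^] p) [^] j \<otimes> (d [^] p) [^] i"
        by (simp add: int_pow_pow mult.commute)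
      finally show ?thesis
        using subgroup.m_closed[OF K] subgroup_int_pow_closed[OF K] gens by simp
    qed
    moreover have "c' [^] p = t [^] p \<otimes> c [^] m"
      unfolding c'_def m_def using int_pow_mult_distrib[OF de_central[OF t]] tc
      by (simp add: int_pow_pow)
    then have "c [^] m = inv (t [^] p) \<otimes> c' [^] p" using tc by (simp add: mult_inv_cancel)
    ultimately have "c [^] m \<in> K"
      using subgroup.m_closed[OF K] subgroup.m_inv_closed[OF K] subgroup_int_pow_closed[OF K] gens
      by simp
    then have "finite ((\<lambda>x. K #> x) ` ext_abcde)"
      using m gens
      by (intro finite_cosets_abcde[OF K, of "nat m"] Kpow[of a n "n * p"] Kpow[of b n "n * p"]
          Kpow[of c m 1] Kpow[of d p "n * n"] Kpow[of e p "n * n"]) (auto simp: m_def)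
    moreover have "rcosets K = (\<lambda>x. K #> x) ` carrier G" unfolding RCOSETS_def by blast
    ultimately show ?thesis by (simp add: ext_abcde_eq)
  qed
  moreover have "f ` K = carrier G"
  proof
    show "f ` K \<subseteq> carrier G" using f unfolding hom_def by auto
    show "carrier G \<subseteq> f ` K"
    proof
      fix g assume "g \<in> carrier G"
      then obtain j i z y x :: int where
        "g = e [^] j \<otimes> d [^] i \<otimes> c [^] z \<otimes> b [^] y \<otimes> a [^] x"
        using ext_abcde_iff ext_abcde_eq by blast
      then obtain h where "(g, h) \<in> \<Gamma>" using \<Gamma>_iff by blast
      then show "g \<in> f ` K" using f_eq unfolding K_def by force
    qed
  qed
  moreover have "N = {\<one>}" if N: "N \<lhd> G" "N \<subseteq> K" "f ` N \<subseteq> N" for N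
  proof -
    have preimage: "\<exists>g\<in>N. (g, h) \<in> \<Gamma>" if "h \<in> N" for h
    proof -
      obtain g where "(g, h) \<in> \<Gamma>" using \<open>h \<in> N\<close> N(2) unfolding K_def by force
      then show ?thesis using f_eq N(3) \<open>h \<in> N\<close> by blast
    qed
    have zero: "x = 0 \<and> y = 0 \<and> z = 0"
      if "s \<in> ext_de" "s \<otimes> c [^] z \<otimes> b [^] y \<otimes> a [^] x \<in> N" for s and x y z :: int
      by (rule exponents_zero[OF n _ that])
        (use preimage \<Gamma>_normal_form de_mult in metis)
    \<comment> \<open>With all exponents zero, \<open>f\<close> extracts \<open>p\<close>-th roots
      on \<open>N\<close>, and these roots lie in both \<open>N\<close> and
      \<open>ext_de\<close>.\<close>
    have root: "\<exists>g\<in>N. g \<in> ext_de \<and> h = g [^] p" if "h \<in> N" for h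
    proof -
      obtain g where g: "g \<in> N" "(g, h) \<in> \<Gamma>" using preimage \<open>h \<in> N\<close> by blast
      obtain s and z y x :: int where s: "s \<in> ext_de" and gs: "g = s \<otimes> c [^] z \<otimes> b [^] y \<otimes> a [^] x"
        and hs: "h = s [^] p \<otimes> t [^] z \<otimes> c [^] (n * n * z) \<otimes> b [^] (n * y) \<otimes> a [^] (n * x)"
        using \<Gamma>_normal_form[OF g(2)] by blast
      have "x = 0" "y = 0" "z = 0" using zero[OF s] g gs by auto
      moreover have "s \<in> carrier G" using s de_subset_carrier by blast
      ultimately have "g = s" "h = s [^] p" using gs hs by auto
      then show ?thesis using g s by blast
    qed
    have "N \<subseteq> ext_de" using root de_pow by blast
    then have "N \<subseteq> {\<one>}" by (rule divisible_subset_de_trivial[OF _ p]) (use root in blast)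
    moreover have "\<one> \<in> N" using N(1) normal_imp_subgroup subgroup.one_closed by blast
    ultimately show ?thesis by blast
  qed
  ultimately show ?thesis using that K f by blast
qed

end

subsection \<open>Commutators and the lower central series\<close>

context group
begin

lemma commutator_closed: "x \<in> carrier G \<Longrightarrow> y \<in> carrier G \<Longrightarrow> commutator G x y \<in> carrier G"
  unfolding commutator_def by simp

lemma mult_commutator:
  "x \<in> carrier G \<Longrightarrow> y \<in> carrier G \<Longrightarrow> x \<otimes> y = y \<otimes> x \<otimes> commutator G x y"
  unfolding commutator_def by (simp add: m_assoc mult_inv_cancel)

lemma commutator_eqI:
  assumes "x \<in> carrier G" "y \<in> carrier G" "z \<in> carrier G" "x \<otimes> y = y \<otimes> x \<otimes> z"
  shows "commutator G x y = z"
proof -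
  have "commutator G x y = inv (y \<otimes> x) \<otimes> (x \<otimes> y)"
    using assms(1,2) unfolding commutator_def by (simp add: m_assoc inv_mult_group)
  also have "\<dots> = z"
    unfolding assms(4) using assms(1-3) by (simp add: m_assoc inv_mult_group mult_inv_cancel)
  finally show ?thesis .
qed

lemma commutator_eq_one_iff:
  assumes "x \<in> carrier G" "y \<in> carrier G"
  shows "commutator G x y = \<one> \<longleftrightarrow> x \<otimes> y = y \<otimes> x"
proof
  assume "commutator G x y = \<one>"
  then show "x \<otimes> y = y \<otimes> x" using mult_commutator[OF assms] assms by simp
next
  assume "x \<otimes> y = y \<otimes> x"
  then show "commutator G x y = \<one>" using assms by (intro commutator_eqI) simp_all
qed

text \<open>For trivial \<open>Z\<close> this is the centralizer of \<open>x\<close>; in general it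
  is the preimage of the centralizer of its image in \<open>G / Z\<close>. Being central, the
  factors from \<open>Z\<close> can be collected on the right.\<close>

lemma subgroup_commutes_modulo:
  assumes Z: "subgroup Z G" and central: "\<And>z x. z \<in> Z \<Longrightarrow> x \<in> carrier G \<Longrightarrow> z \<otimes> x = x \<otimes> z"
    and x: "x \<in> carrier G"
  shows "subgroup {g \<in> carrier G. \<exists>z\<in>Z. g \<otimes> x = x \<otimes> g \<otimes> z} G"
proof (rule subgroupI)
  show "{g \<in> carrier G. \<exists>z\<in>Z. g \<otimes> x = x \<otimes> g \<otimes> z} \<noteq> {}"
    using subgroup.one_closed[OF Z] x by (auto intro!: exI[of _ \<one>] bexI[of _ \<one>])
next
  fix g assume "g \<in> {g \<in> carrier G. \<exists>z\<in>Z. g \<otimes> x = x \<otimes> g \<otimes> z}"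
  then obtain z where g: "g \<in> carrier G" and z: "z \<in> Z" and eq: "g \<otimes> x = x \<otimes> g \<otimes> z" by blast
  have zc: "z \<in> carrier G" using z subgroup.mem_carrier[OF Z] by blast
  have "x \<otimes> inv g = inv g \<otimes> (g \<otimes> x) \<otimes> inv g" using g x by (simp add: m_assoc mult_inv_cancel)
  also have "\<dots> = inv g \<otimes> (x \<otimes> g \<otimes> z) \<otimes> inv g" by (simp only: eq)
  also have "\<dots> = inv g \<otimes> x \<otimes> g \<otimes> (z \<otimes> inv g)" using g x zc by (simp add: m_assoc)
  also have "z \<otimes> inv g = inv g \<otimes> z" by (rule central[OF z inv_closed[OF g]])
  finally have "x \<otimes> inv g = inv g \<otimes> x \<otimes> z" using g x zc by (simp add: m_assoc mult_inv_cancel)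
  then have "inv g \<otimes> x = x \<otimes> inv g \<otimes> inv z" using g x zc by (simp add: m_assoc)
  then show "inv g \<in> {g \<in> carrier G. \<exists>z\<in>Z. g \<otimes> x = x \<otimes> g \<otimes> z}"
    using g subgroup.m_inv_closed[OF Z z] by auto
next
  fix g h assume "g \<in> {g \<in> carrier G. \<exists>z\<in>Z. g \<otimes> x = x \<otimes> g \<otimes> z}"
    "h \<in> {g \<in> carrier G. \<exists>z\<in>Z. g \<otimes> x = x \<otimes> g \<otimes> z}"
  then obtain z w where gh: "g \<in> carrier G" "h \<in> carrier G" and z: "z \<in> Z" and w: "w \<in> Z"
    and eq: "g \<otimes> x = x \<otimes> g \<otimes> z" "h \<otimes> x = x \<otimes> h \<otimes> w" by blast
  have zw: "z \<in> carrier G" "w \<in> carrier G" using z w subgroup.mem_carrier[OF Z] by auto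
  have "g \<otimes> h \<otimes> x = (g \<otimes> x) \<otimes> h \<otimes> w" using gh x zw eq(2) by (simp add: m_assoc)
  also have "\<dots> = x \<otimes> g \<otimes> (z \<otimes> h) \<otimes> w" using gh x zw eq(1) by (simp add: m_assoc)
  also have "z \<otimes> h = h \<otimes> z" by (rule central[OF z gh(2)])
  finally have "g \<otimes> h \<otimes> x = x \<otimes> (g \<otimes> h) \<otimes> (z \<otimes> w)" using gh x zw by (simp add: m_assoc)
  then show "g \<otimes> h \<in> {g \<in> carrier G. \<exists>z\<in>Z. g \<otimes> x = x \<otimes> g \<otimes> z}"
    using gh subgroup.m_closed[OF Z z w] by auto
qed auto

lemma subgroup_centralizer:
  assumes "x \<in> carrier G"
  shows "subgroup {g \<in> carrier G. g \<otimes> x = x \<otimes> g} G"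
proof -
  have "{g \<in> carrier G. g \<otimes> x = x \<otimes> g} = {g \<in> carrier G. \<exists>z\<in>{\<one>}. g \<otimes> x = x \<otimes> g \<otimes> z}"
    using assms by auto
  then show ?thesis
    using subgroup_commutes_modulo[OF triv_subgroup _ assms] by simp
qed

lemma subgroup_center: "subgroup {z \<in> carrier G. \<forall>x\<in>carrier G. z \<otimes> x = x \<otimes> z} G"
proof -
  have "{z \<in> carrier G. \<forall>x\<in>carrier G. z \<otimes> x = x \<otimes> z} =
      \<Inter> ((\<lambda>x. {g \<in> carrier G. g \<otimes> x = x \<otimes> g}) ` carrier G)"
    by auto
  also have "subgroup \<dots> G"
    by (rule subgroups_Inter) (auto intro!: subgroup_centralizer)
  finally show ?thesis .
qed

text \<open>\<open>c = [a, b]\<close> commutes with both generators, so it is central. Then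
  \<open>a\<close> and \<open>b\<close> commute modulo the center, hence so do any two elements, and
  all commutators are central.\<close>

lemma lower_central_2_trivial:
  assumes ab: "a \<in> carrier G" "b \<in> carrier G" and gen: "generate G {a, b} = carrier G"
    and ca: "commutator G (commutator G a b) a = \<one>" and cb: "commutator G (commutator G a b) b = \<one>"
  shows "lower_central G 2 = {\<one>}"
proof -
  define Z where "Z = {z \<in> carrier G. \<forall>x\<in>carrier G. z \<otimes> x = x \<otimes> z}"
  have Z: "subgroup Z G" unfolding Z_def by (rule subgroup_center)
  define S where "S x = {g \<in> carrier G. \<exists>z\<in>Z. g \<otimes> x = x \<otimes> g \<otimes> z}" for x
  have whole: "H = carrier G" if "subgroup H G" "a \<in> H" "b \<in> H" for H
    using generate_subgroup_incl[of "{a, b}" H] that gen subgroup.subset[of H G] by auto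
  define c where "c = commutator G a b"
  have c: "c \<in> carrier G" unfolding c_def using ab by (rule commutator_closed)
  have "{g \<in> carrier G. g \<otimes> c = c \<otimes> g} = carrier G"
    using ca cb ab commutator_eq_one_iff[OF c] unfolding c_def[symmetric]
    by (intro whole subgroup_centralizer c) simp_all
  then have cZ: "c \<in> Z" unfolding Z_def using c by force
  have SZ: "subgroup (S x) G" if "x \<in> carrier G" for x
    unfolding S_def by (rule subgroup_commutes_modulo[OF Z _ that]) (simp add: Z_def)
  have self: "x \<in> S x" if "x \<in> carrier G" for x
    unfolding S_def using that subgroup.one_closed[OF Z] by (auto intro!: bexI[of _ \<one>])
  have sym: "y \<in> S x" if xy: "x \<in> S y" "y \<in> carrier G" for x y
  proof -
    obtain z where x: "x \<in> carrier G" and z: "z \<in> Z" and eq: "x \<otimes> y = y \<otimes> x \<otimes> z"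
      using xy(1) unfolding S_def by blast
    have "y \<otimes> x = x \<otimes> y \<otimes> inv z"
      using eq x xy(2) subgroup.mem_carrier[OF Z z] by (simp add: m_assoc)
    then show ?thesis unfolding S_def using xy(2) subgroup.m_inv_closed[OF Z z] by blast
  qed
  have aSb: "a \<in> S b"
    unfolding S_def using cZ mult_commutator[OF ab] ab c_def by blast
  \<comment> \<open>\<open>S a\<close> and \<open>S b\<close> contain both generators. By symmetry
    every \<open>S x\<close> then contains \<open>a\<close> and \<open>b\<close>, so it is the whole
    group as well.\<close>
  have "S a = carrier G" "S b = carrier G"
    using whole SZ self aSb sym ab by blast+
  then have "S x = carrier G" if "x \<in> carrier G" for x
    using whole[OF SZ[OF that]] sym that ab by blast
  then have comm: "commutator G x y \<in> Z" if "x \<in> carrier G" "y \<in> carrier G" for x y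
  proof -
    have "x \<in> S y" using \<open>\<And>x. x \<in> carrier G \<Longrightarrow> S x = carrier G\<close> that by blast
    then obtain z where z: "z \<in> Z" "x \<otimes> y = y \<otimes> x \<otimes> z" unfolding S_def by blast
    then show ?thesis using commutator_eqI[OF that _ z(2)] subgroup.mem_carrier[OF Z] by simp
  qed
  have "lower_central G 1 \<subseteq> Z"
    using generate_subgroup_incl[OF _ Z, of "{commutator G x y | x y. x \<in> carrier G \<and> y \<in> carrier G}"] comm
    by auto
  then have "{commutator G x y | x y. x \<in> lower_central G 1 \<and> y \<in> carrier G} \<subseteq> {\<one>}"
    using commutator_eq_one_iff unfolding Z_def by blast
  then have "lower_central G 2 \<subseteq> {\<one>}"
    using generate_subgroup_incl[OF _ triv_subgroup] by (simp add: numeral_2_eq_2)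
  moreover have "\<one> \<in> lower_central G 2" by (simp add: numeral_2_eq_2 generate.one)
  ultimately show ?thesis by blast
qed

lemma torsion_free_int_pow:
  assumes "torsion_free_group G" "x \<in> carrier G" "k \<noteq> 0" "x [^] (k::int) = \<one>"
  shows "x = \<one>"
proof -
  have "x [^] \<bar>k\<bar> = \<one>" using assms(2,4) by (simp add: abs_if int_pow_neg)
  then have "x [^] nat \<bar>k\<bar> = \<one>" by (simp add: pow_nat)
  moreover have "nat \<bar>k\<bar> > 0" using assms(3) by simp
  ultimately show ?thesis using assms(1,2) unfolding torsion_free_group_def by blast
qed

text \<open>Commutators of \<open>[c, y]\<close> with any element lie in
  \<open>lower_central G 3\<close>, which is trivial, so \<open>d\<close> and \<open>e\<close> are
  central. If both were trivial, \<open>lower_central_2_trivial\<close> would make the class smaller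
  than three.\<close>

lemma torsion_free_class_3I:
  assumes tf: "torsion_free_group G" and cl: "has_nilpotency_class G 3"
    and ab: "a \<in> carrier G" "b \<in> carrier G" and gen: "generate G {a, b} = carrier G"
  defines "c \<equiv> commutator G a b"
  shows "torsion_free_class_3 G a b c (commutator G c a) (commutator G c b)"
proof -
  have cc: "c \<in> carrier G" unfolding c_def using ab by (rule commutator_closed)
  have c1: "c \<in> lower_central G (Suc 0)"
    unfolding c_def using ab by (auto intro!: generate.incl)
  have central: "commutator G c y \<otimes> x = x \<otimes> commutator G c y"
    if "y \<in> carrier G" "x \<in> carrier G" for x y
  proof -
    have "commutator G c y \<in> lower_central G (Suc (Suc 0))"
      unfolding lower_central.simps(2)[of _ "Suc 0"] using c1 that(1) by (blast intro: generate.incl)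
    then have "commutator G (commutator G c y) x \<in> lower_central G 3"
      unfolding numeral_3_eq_3 lower_central.simps(2)[of _ "Suc (Suc 0)"]
      using that(2) by (blast intro: generate.incl)
    then show ?thesis
      using cl commutator_eq_one_iff commutator_closed cc that
      unfolding has_nilpotency_class_def by simp
  qed
  have "lower_central G 2 \<noteq> {\<one>}" using cl unfolding has_nilpotency_class_def by simp
  then have nontrivial: "commutator G c a \<noteq> \<one> \<or> commutator G c b \<noteq> \<one>"
    using lower_central_2_trivial[OF ab gen] unfolding c_def by blast
  note rules = ab cc gen nontrivial commutator_closed mult_commutator[OF ab, folded c_def]
    mult_commutator[OF cc] central[OF ab(1)] central[OF ab(2)] torsion_free_int_pow[OF tf]
  show ?thesis
    by unfold_locales (assumption | rule rules)+
qed

end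

section \<open>Choice of the exponent for a given finite-index subgroup\<close>

theorem theoremA:
  fixes G :: "('a, 'b) monoid_scheme" (structure)
  assumes "group G"
    and "torsion_free_group G"
    and "has_nilpotency_class G 3"
    and "\<exists>a\<in>carrier G. \<exists>b\<in>carrier G. generate G {a, b} = carrier G"
  shows "strongly_recurrent_self_similar G"
  unfolding strongly_recurrent_self_similar_def
proof (intro allI impI)
  interpret group G by fact
  obtain a b where ab_carrier: "a \<in> carrier G" "b \<in> carrier G" and gen: "generate G {a, b} = carrier G"
    using assms(4) by blast
  interpret torsion_free_class_3 G a b "commutator G a b" "commutator G (commutator G a b) a"
    "commutator G (commutator G a b) b"
    by (rule torsion_free_class_3I[OF assms(2,3) ab_carrier gen])
  fix H assume fin_H: "finite_index_subgroup H G"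
  then have H: "subgroup H G" unfolding finite_index_subgroup_def by blast
  obtain k l :: nat where k: "k > 0" "a [^] k \<in> H" and l: "l > 0" "b [^] l \<in> H"
    using finite_index_pow_mem[OF fin_H ab_carrier(1)] finite_index_pow_mem[OF fin_H ab_carrier(2)]
    by metis
  \<comment> \<open>A common multiple of \<open>k\<close> and \<open>l\<close> puts
    \<open>a^n\<close> and \<open>b^n\<close> into \<open>H\<close>; the factor 2 secures
    \<open>n \<ge> 2\<close> even when \<open>k = l = 1\<close>.\<close>
  define n where "n = 2 * int k * int l"
  have "1 * 1 \<le> int k * int l" using k l by (intro mult_mono) auto
  then have n: "n \<ge> 2" unfolding n_def by simp
  have "a [^] n = (a [^] k) [^] (2 * int l)" "b [^] n = (b [^] l) [^] (2 * int k)"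
    unfolding n_def using ab_carrier by (simp_all add: int_pow_pow ac_simps flip: int_pow_int)
  then have "a [^] n \<in> H" "b [^] n \<in> H"
    using k l subgroup_int_pow_closed[OF H] by auto
  then obtain K f where K: "subgroup K G" "K \<subseteq> H" "finite (rcosets K)"
    and f: "f \<in> hom (G\<lparr>carrier := K\<rparr>) G" "f ` K = carrier G"
      "\<And>N. N \<lhd> G \<Longrightarrow> N \<subseteq> K \<Longrightarrow> f ` N \<subseteq> N \<Longrightarrow> N = {\<one>}"
    using self_similarity_witness[OF H n] by metis
  \<comment> \<open>Cosets of \<open>K\<close> in \<open>H\<close> are formed with the product of
    \<open>G\<close>, so finite index in \<open>G\<close> passes to \<open>H\<close>.\<close>
  have "rcosets\<^bsub>G\<lparr>carrier := H\<rparr>\<^esub> K \<subseteq> rcosets K"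
    using subgroup.subset[OF H] unfolding RCOSETS_def r_coset_def by auto
  then have "finite_index_subgroup K (G\<lparr>carrier := H\<rparr>)"
    unfolding finite_index_subgroup_def using subgroup_incl[OF K(1) H K(2)] K(3) finite_subset by blast
  moreover have "virtual_endomorphism G K f"
    unfolding virtual_endomorphism_def finite_index_subgroup_def using K f by blast
  ultimately show "\<exists>K f. finite_index_subgroup K (G\<lparr>carrier := H\<rparr>) \<and>
      simple_virtual_endomorphism G K f \<and> recurrent_virtual_endomorphism G K f"
    unfolding simple_virtual_endomorphism_def recurrent_virtual_endomorphism_def using f by blast
qed

end
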